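(* Let $\sigma^2>0$. For each $n\ge1$ let $X_n$ be a random vector in $\mathbb{R}^{d_n}$ such that, as $n\to\infty$, $\|X_n\|^2\to\sigma^2$ in probability and $X_n'\widetilde X_n\to0$ in probability, where $\widetilde X_n$ denotes an independent copy of $X_n$. Let $\{\Xi_n\in\mathbb{R}^{d_n},\,n\ge1\}$ be random vectors independent of $\{X_n,\,n\ge1\}$, and suppose that there is a function $\psi_0:[0,\infty)\to\mathbb{R}$ (not depending on $n$) such that $\mathbb{E}\exp(\mathrm{i}u'\Xi_n)=\psi_0(\|u\|^2)$ for all $u\in\mathbb{R}^{d_n}$ and all $n\ge1$. Define $Y_n=\Xi_n'X_n$, $n\ge1$. Then $\Xi_n\sim\mathcal{N}_{d_n}(0,\sigma_0^2I_{d_n})$ for some $\sigma_0$ (for all $n$) if and only if, for all $t\in\mathbb{R}$, $$\mathrm{Var}_{\Xi_n}\big(\varphi_{Y_n|\Xi_n}(t)\big):=\mathbb{E}_{\Xi_n}\big|\varphi_{Y_n|\Xi_n}(t)\big|^2-\big|\mathbb{E}_{\Xi_n}\varphi_{Y_n|\Xi_n}(t)\big|^2\to0\quad\text{as } n\to\infty.$$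
   Context: Conventions: vectors are column vectors, $'$ denotes transpose, $\|\cdot\|$ is the Euclidean norm. The dimensions $d_1,d_2,\ldots$ form a monotonically increasing sequence of positive integers with $d_n\to\infty$. All random vectors are continuous with continuous density functions. $\mathcal{N}_d(0,\Sigma)$ is the $d$-dimensional normal distribution with mean $0$ and covariance matrix $\Sigma$. $\varphi_{Y_n|\Xi_n}(t)=\mathbb{E}[\exp(\mathrm{i}tY_n)\mid\Xi_n]$, $t\in\mathbb{R}$, is the conditional characteristic function of $Y_n$ given $\Xi_n$, and $\mathbb{E}_{\Xi_n}$ denotes expectation with respect to the distribution of $\Xi_n$. *)

theory Defs
  imports "HOL-Probability.Probability"
begin

text \<open>The dimension varies along the sequence, so a vector in \<open>\<real>\<^sup>d\<close> is represented by its coordinate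
  function on \<open>{..<d}\<close>, and \<open>\<real>\<^sup>d\<close> by the \<open>d\<close>-fold product of Lebesgue--Borel measure. Its space
  is \<open>extensional {..<d}\<close>. The Euclidean norm is \<^term>\<open>L2_set x {..<d}\<close>.\<close>

abbreviation lborel_vec :: "nat \<Rightarrow> (nat \<Rightarrow> real) measure"
  where "lborel_vec d \<equiv> PiM {..<d} (\<lambda>_. lborel)"

definition dot :: "nat \<Rightarrow> (nat \<Rightarrow> real) \<Rightarrow> (nat \<Rightarrow> real) \<Rightarrow> real"
  where "dot d x y = (\<Sum>i<d. x i * y i)"

definition continuous_random_vector :: "'a measure \<Rightarrow> nat \<Rightarrow> ('a \<Rightarrow> nat \<Rightarrow> real) \<Rightarrow> bool"
  where "continuous_random_vector M d X \<longleftrightarrow>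
    (\<exists>f :: (nat \<Rightarrow> real) \<Rightarrow> real.
       continuous_on (extensional {..<d}) f \<and> (\<forall>x\<in>extensional {..<d}. 0 \<le> f x) \<and>
       distributed M (lborel_vec d) X (\<lambda>x. ennreal (f x)))"

text \<open>\<open>X \<sim> N\<^sub>d(0, s\<^sup>2 I\<^sub>d)\<close>, in the nondegenerate case \<open>s > 0\<close>, where it is given by its density.\<close>

definition isotropic_normal_density :: "nat \<Rightarrow> real \<Rightarrow> (nat \<Rightarrow> real) \<Rightarrow> real"
  where "isotropic_normal_density d s x =
    (2 * pi * s\<^sup>2) powr (- real d / 2) * exp (- (L2_set x {..<d})\<^sup>2 / (2 * s\<^sup>2))"

definition isotropic_normal :: "'a measure \<Rightarrow> nat \<Rightarrow> real \<Rightarrow> ('a \<Rightarrow> nat \<Rightarrow> real) \<Rightarrow> bool"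
  where "isotropic_normal M d s X \<longleftrightarrow>
    0 < s \<and> distributed M (lborel_vec d) X (\<lambda>x. ennreal (isotropic_normal_density d s x))"

definition conv_in_prob :: "'a measure \<Rightarrow> (nat \<Rightarrow> 'a \<Rightarrow> real) \<Rightarrow> real \<Rightarrow> bool"
  where "conv_in_prob M Z c \<longleftrightarrow>
    (\<forall>\<epsilon>>0. (\<lambda>n. measure M {\<omega>\<in>space M. \<epsilon> < \<bar>Z n \<omega> - c\<bar>}) \<longlonglongrightarrow> 0)"

text \<open>The two coordinates of \<^term>\<open>M \<Otimes>\<^sub>M M\<close> carry two independent copies of a random vector \<open>X\<close> on
  \<open>M\<close>. Convergence in probability only depends on the joint law, so this does not presuppose
  that \<open>M\<close> itself is rich enough to carry an independent copy; if it is, the following lemma shows that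
  nothing changes by using that copy instead.\<close>

definition conv_in_prob_dot_indep_copy ::
    "'a measure \<Rightarrow> (nat \<Rightarrow> nat) \<Rightarrow> (nat \<Rightarrow> 'a \<Rightarrow> nat \<Rightarrow> real) \<Rightarrow> real \<Rightarrow> bool"
  where "conv_in_prob_dot_indep_copy M d X c \<longleftrightarrow>
    conv_in_prob (M \<Otimes>\<^sub>M M) (\<lambda>n (\<omega>, \<omega>'). dot (d n) (X n \<omega>) (X n \<omega>')) c"

lemma measurable_dot [measurable]:
  "(\<lambda>(x, y). dot d x y) \<in> borel_measurable (lborel_vec d \<Otimes>\<^sub>M lborel_vec d)"
  unfolding dot_def split_beta by measurable

lemma conv_in_prob_dot_indep_copy_iff:
  fixes X X' :: "nat \<Rightarrow> 'a \<Rightarrow> nat \<Rightarrow> real"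
  assumes M: "prob_space M"
    and copy: "\<And>n. distr M (lborel_vec (d n)) (X' n) = distr M (lborel_vec (d n)) (X n)"
    and indep: "\<And>n. prob_space.indep_var M (lborel_vec (d n)) (X n) (lborel_vec (d n)) (X' n)"
  shows "conv_in_prob_dot_indep_copy M d X c \<longleftrightarrow>
    conv_in_prob M (\<lambda>n \<omega>. dot (d n) (X n \<omega>) (X' n \<omega>)) c"
proof -
  interpret prob_space M by (rule M)
  have "measure (M \<Otimes>\<^sub>M M) {\<omega>\<in>space (M \<Otimes>\<^sub>M M). \<epsilon> < \<bar>(case \<omega> of (a, b) \<Rightarrow> dot (d n) (X n a) (X n b)) - c\<bar>}
      = measure M {\<omega>\<in>space M. \<epsilon> < \<bar>dot (d n) (X n \<omega>) (X' n \<omega>) - c\<bar>}" (is "?l = ?r") for n \<epsilon>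
  proof -
    let ?S = "lborel_vec (d n)"
    have X[measurable]: "X n \<in> measurable M ?S" and X'[measurable]: "X' n \<in> measurable M ?S"
      using indep_var_rv1[OF indep] indep_var_rv2[OF indep] by auto
    define A where "A = {p\<in>space (?S \<Otimes>\<^sub>M ?S). \<epsilon> < \<bar>(case p of (x, y) \<Rightarrow> dot (d n) x y) - c\<bar>}"
    have A: "A \<in> sets (?S \<Otimes>\<^sub>M ?S)" unfolding A_def by measurable
    have sf: "sigma_finite_measure (distr M ?S (X n))"
      using prob_space_distr[OF X] prob_space_imp_sigma_finite by blast
    have "distr M (?S \<Otimes>\<^sub>M ?S) (\<lambda>\<omega>. (X n \<omega>, X' n \<omega>)) = distr M ?S (X n) \<Otimes>\<^sub>M distr M ?S (X n)"
      using indep[of n] copy[of n] unfolding indep_var_distribution_eq by metis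
    also have "\<dots> = distr (M \<Otimes>\<^sub>M M) (?S \<Otimes>\<^sub>M ?S) (\<lambda>(a, b). (X n a, X n b))"
      by (rule pair_measure_distr[OF X X sf])
    finally have eq: "distr M (?S \<Otimes>\<^sub>M ?S) (\<lambda>\<omega>. (X n \<omega>, X' n \<omega>)) =
        distr (M \<Otimes>\<^sub>M M) (?S \<Otimes>\<^sub>M ?S) (\<lambda>(a, b). (X n a, X n b))" .
    have "?l = measure (distr (M \<Otimes>\<^sub>M M) (?S \<Otimes>\<^sub>M ?S) (\<lambda>(a, b). (X n a, X n b))) A"
      using measurable_space[OF X] A
      by (subst measure_distr)
        (auto simp: A_def space_pair_measure intro!: arg_cong[where f="measure (M \<Otimes>\<^sub>M M)"])
    also have "\<dots> = ?r"
      using measurable_space[OF X] measurable_space[OF X'] A unfolding eq[symmetric]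
      by (subst measure_distr)
        (auto simp: A_def space_pair_measure intro!: arg_cong[where f="measure M"])
    finally show ?thesis .
  qed
  then show ?thesis by (simp add: conv_in_prob_dot_indep_copy_def conv_in_prob_def)
qed

text \<open>The library's conditional expectation is real-valued; it is extended to complex random variables
  componentwise.\<close>

definition complex_cond_exp :: "'a measure \<Rightarrow> 'a measure \<Rightarrow> ('a \<Rightarrow> complex) \<Rightarrow> 'a \<Rightarrow> complex"
  where "complex_cond_exp M F f \<omega> =
    Complex (real_cond_exp M F (\<lambda>x. Re (f x)) \<omega>) (real_cond_exp M F (\<lambda>x. Im (f x)) \<omega>)"

text \<open>\<open>E[exp(i t Y) | \<Xi>]\<close>, i.e. conditional on the \<open>\<sigma>\<close>-algebra generated by \<open>\<Xi>\<close>.\<close>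

definition cond_char ::
    "'a measure \<Rightarrow> 'b measure \<Rightarrow> ('a \<Rightarrow> 'b) \<Rightarrow> ('a \<Rightarrow> real) \<Rightarrow> real \<Rightarrow> 'a \<Rightarrow> complex"
  where "cond_char M S \<Xi> Y t =
    complex_cond_exp M (vimage_algebra (space M) \<Xi> S) (\<lambda>\<omega>. iexp (t * Y \<omega>))"

text \<open>For random variables that are functions of \<open>\<Xi>\<close>, expectation under the law of \<open>\<Xi>\<close> is expectation
  under \<open>M\<close>.\<close>

definition var_cond_char ::
    "'a measure \<Rightarrow> 'b measure \<Rightarrow> ('a \<Rightarrow> 'b) \<Rightarrow> ('a \<Rightarrow> real) \<Rightarrow> real \<Rightarrow> real"
  where "var_cond_char M S \<Xi> Y t =
    (\<integral>\<omega>. (cmod (cond_char M S \<Xi> Y t \<omega>))\<^sup>2 \<partial>M) - (cmod (\<integral>\<omega>. cond_char M S \<Xi> Y t \<omega> \<partial>M))\<^sup>2"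

end

theory Submission
  imports Defs
begin

text \<open>By independence and Fubini, \<open>E|\<phi>|\<^sup>2 = E \<psi>\<^sub>0(t\<^sup>2 \<parallel>X - X'\<parallel>\<^sup>2)\<close> and \<open>E \<phi> = E \<psi>\<^sub>0(t\<^sup>2 \<parallel>X\<parallel>\<^sup>2)\<close>, so the
  variance tends to \<open>\<psi>\<^sub>0(2r) - \<psi>\<^sub>0(r)\<^sup>2\<close> with \<open>r = t\<^sup>2\<sigma>\<^sup>2\<close>. If this vanishes for all \<open>r\<close>, then averages over
  \<open>N\<close> coordinates of \<open>cos (\<surd>a \<xi>\<^sub>i)\<close> have variance \<open>O(1/N)\<close>, hence so do their covariances,
  whose leading term is \<open>\<psi>\<^sub>0(a + b) - \<psi>\<^sub>0(a) \<psi>\<^sub>0(b)\<close>. Since \<open>N\<close> may be as large as \<open>d\<^sub>n\<close>, this is zero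
  and \<open>\<psi>\<^sub>0\<close> is an exponential; this replaces Schoenberg's representation of \<open>\<psi>\<^sub>0\<close> as a mixture of
  exponentials. The constant \<open>\<psi>\<^sub>0 = 1\<close> is excluded because it would force a point mass at \<open>0\<close>.\<close>

section \<open>The exponential functional equation on the half-line\<close>

text \<open>Once f is known to be positive, \<open>f (1 / (n + 1))\<close> must be the positive root
  of \<open>f 1\<close>, so \<open>pow\<close> determines f at all nonnegative rationals; continuity
  extends the formula. The normalization \<open>f 0 = 1\<close> rules out the zero solution.\<close>

lemma multiplicative_eq_exp:
  fixes f :: "real \<Rightarrow> real"
  assumes mult: "\<And>a b. 0 \<le> a \<Longrightarrow> 0 \<le> b \<Longrightarrow> f (a + b) = f a * f b"
    and cont: "continuous_on {0..} f" and f0: "f 0 = 1"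
  shows "\<exists>c. \<forall>x\<ge>0. f x = exp (c * x)"
proof -
  have lim: "(\<lambda>n. f (s n)) \<longlonglongrightarrow> f x" if "s \<longlonglongrightarrow> x" "\<And>n. 0 \<le> s n" "0 \<le> x" for s x
    using continuous_on_tendsto_compose[OF cont that(1)] that by auto
  have pow: "f (real k * x) = f x ^ k" if "0 \<le> x" for k x
    using that by (induction k) (auto simp: f0 distrib_right mult)
  have pos: "0 < f x" if x: "0 \<le> x" for x
  proof -
    have "f x = f (x/2) ^ 2" using mult[of "x/2" "x/2"] x by (simp add: power2_eq_square)
    \<comment> \<open>A zero at x passes to every x / (n + 1), because a power vanishes only with
      its base. These points tend to 0, where f is 1.\<close>
    moreover have False if "f x = 0"
    proof -
      have "f (x * inverse (real (Suc n))) = 0" for n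
        using pow[of "x * inverse (real (Suc n))" "Suc n"] x that
        by (simp add: field_simps del: power_Suc of_nat_Suc)
      moreover have "(\<lambda>n. f (x * inverse (real (Suc n)))) \<longlonglongrightarrow> f 0"
        using x LIMSEQ_inverse_real_of_nat[THEN tendsto_mult_left, of x] by (intro lim) auto
      ultimately show False using f0 by (simp add: LIMSEQ_const_iff)
    qed
    ultimately show ?thesis by (metis zero_le_power2 order_le_less)
  qed
  define c where "c = ln (f 1)"
  have rat: "f (real k / real (Suc n)) = exp (c * (real k / real (Suc n)))" for k n
  proof -
    have "f (1 / real (Suc n)) ^ Suc n = f 1"
      using pow[of "1 / real (Suc n)" "Suc n"] by (simp del: power_Suc of_nat_Suc)
    then have "c = real (Suc n) * ln (f (1 / real (Suc n)))"
      unfolding c_def using pos[of "1 / real (Suc n)"] by (metis ln_realpow zero_le_divide_1_iff of_nat_0_le_iff)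
    then have "f (1 / real (Suc n)) = exp (c / real (Suc n))"
      using pos[of "1 / real (Suc n)"] by simp
    then show ?thesis
      using pow[of "1 / real (Suc n)" k] by (simp add: exp_of_nat_mult[symmetric] mult_ac)
  qed
  have "f x = exp (c * x)" if x: "0 \<le> x" for x
  proof -
    \<comment> \<open>Rounding x * (n + 1) down gives fractions that lie at most 1 / (n + 1) below
      x.\<close>
    define s where "s n = real (nat \<lfloor>x * real (Suc n)\<rfloor>) / real (Suc n)" for n
    have "s \<longlonglongrightarrow> x"
    proof (rule real_tendsto_sandwich)
      show "\<forall>\<^sub>F n in sequentially. x - inverse (real (Suc n)) \<le> s n"
      proof (intro always_eventually allI)
        fix n
        have "x * real (Suc n) - 1 \<le> real (nat \<lfloor>x * real (Suc n)\<rfloor>)" using x by linarith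
        then have "(x * real (Suc n) - 1) / real (Suc n) \<le> s n"
          unfolding s_def by (intro divide_right_mono) auto
        then show "x - inverse (real (Suc n)) \<le> s n"
          by (simp add: diff_divide_distrib inverse_eq_divide del: of_nat_Suc)
      qed
      show "\<forall>\<^sub>F n in sequentially. s n \<le> x"
      proof (intro always_eventually allI)
        fix n
        have "real (nat \<lfloor>x * real (Suc n)\<rfloor>) \<le> x * real (Suc n)" using x by simp
        then show "s n \<le> x" unfolding s_def by (simp add: pos_divide_le_eq del: of_nat_Suc)
      qed
      show "(\<lambda>n. x - inverse (real (Suc n))) \<longlonglongrightarrow> x"
        using tendsto_diff[OF tendsto_const LIMSEQ_inverse_real_of_nat, of x] by simp
    qed simp
    moreover have "0 \<le> s n" for n by (simp add: s_def)
    ultimately have "(\<lambda>n. f (s n)) \<longlonglongrightarrow> f x" "(\<lambda>n. exp (c * s n)) \<longlonglongrightarrow> exp (c * x)"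
      using x by (auto intro!: lim tendsto_intros)
    moreover have "f (s n) = exp (c * s n)" for n unfolding s_def by (rule rat)
    ultimately show ?thesis using LIMSEQ_unique by simp
  qed
  then show ?thesis by blast
qed

section \<open>Convergence in probability\<close>

lemma conv_in_probD:
  "conv_in_prob M Z c \<Longrightarrow> 0 < \<epsilon> \<Longrightarrow> (\<lambda>n. measure M {\<omega>\<in>space M. \<epsilon> < \<bar>Z n \<omega> - c\<bar>}) \<longlonglongrightarrow> 0"
  by (simp add: conv_in_prob_def)

text \<open>Continuity at c controls \<open>g (Z n \<omega>)\<close> where
  \<open>Z n \<omega>\<close> is close to c; elsewhere the uniform bound costs at most 2 * B times a
  probability that tends to 0.\<close>

lemma (in prob_space) conv_in_prob_imp_integral_tendsto:
  fixes g :: "real \<Rightarrow> real"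
  assumes Z[measurable]: "\<And>n. Z n \<in> borel_measurable M" and conv: "conv_in_prob M Z c"
    and cont: "isCont g c" and g[measurable]: "g \<in> borel_measurable borel" and bound: "\<And>x. \<bar>g x\<bar> \<le> B"
  shows "(\<lambda>n. \<integral>\<omega>. g (Z n \<omega>) \<partial>M) \<longlonglongrightarrow> g c"
proof (rule LIMSEQ_I)
  fix r :: real assume r: "0 < r"
  from cont obtain \<delta> where \<delta>: "0 < \<delta>" "\<And>x. \<bar>x - c\<bar> < \<delta> \<Longrightarrow> \<bar>g x - g c\<bar> < r / 2"
    unfolding continuous_at_eps_delta dist_real_def using r by (metis half_gt_zero)
  \<comment> \<open>Cutting at \<delta> / 2 makes the complement of the event satisfy a non-strict
    bound by \<delta> / 2, hence the strict bound by \<delta> that continuity asks for.\<close>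
  let ?A = "\<lambda>n. {\<omega>\<in>space M. \<delta> / 2 < \<bar>Z n \<omega> - c\<bar>}"
  have intA: "integrable M (indicator (?A n) :: _ \<Rightarrow> real)" for n
    by (intro integrable_real_indicator) (auto simp: emeasure_eq_measure)
  have B: "0 \<le> B" using bound[of 0] by linarith
  have int: "integrable M (\<lambda>\<omega>. g (Z n \<omega>))" for n
    by (intro integrable_const_bound[of _ B] AE_I2) (auto simp: bound)
  have le: "norm ((\<integral>\<omega>. g (Z n \<omega>) \<partial>M) - g c) \<le> r / 2 + 2 * B * measure M (?A n)" for n
  proof -
    have "(\<integral>\<omega>. g (Z n \<omega>) \<partial>M) - g c = (\<integral>\<omega>. g (Z n \<omega>) - g c \<partial>M)"
      using int by (simp add: prob_space)
    also have "norm \<dots> \<le> (\<integral>\<omega>. norm (g (Z n \<omega>) - g c) \<partial>M)" by (rule integral_norm_bound)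
    also have "\<dots> \<le> (\<integral>\<omega>. r / 2 + 2 * B * indicator (?A n) \<omega> \<partial>M)"
    proof (rule integral_mono)
      fix \<omega> assume "\<omega> \<in> space M"
      then show "norm (g (Z n \<omega>) - g c) \<le> r / 2 + 2 * B * indicator (?A n) \<omega>"
        using \<delta>(2)[of "Z n \<omega>"] bound[of "Z n \<omega>"] bound[of c] \<delta>(1) r
        by (cases "\<omega> \<in> ?A n") (auto simp: indicator_def)
    next
      show "integrable M (\<lambda>\<omega>. r / 2 + 2 * B * indicator (?A n) \<omega>)"
        by (intro Bochner_Integration.integrable_add integrable_const integrable_mult_right intA)
    qed (use int in auto)
    also have "\<dots> = r / 2 + 2 * B * measure M (?A n)"
      by (subst Bochner_Integration.integral_add[OF integrable_const integrable_mult_right[OF intA]])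
        (simp add: prob_space)
    finally show ?thesis .
  qed
  have "(\<lambda>n. r / 2 + 2 * B * measure M (?A n)) \<longlonglongrightarrow> r / 2 + 2 * B * 0"
    using \<delta>(1) by (intro tendsto_intros conv_in_probD[OF conv]) auto
  then have "\<forall>\<^sub>F n in sequentially. r / 2 + 2 * B * measure M (?A n) < r"
    using r by (intro order_tendstoD(2)[where y="r / 2 + 2 * B * 0"]) auto
  then show "\<exists>no. \<forall>n\<ge>no. norm ((\<integral>\<omega>. g (Z n \<omega>) \<partial>M) - g c) < r"
    unfolding eventually_sequentially using le by (meson order_le_less_trans)
qed

lemma (in prob_space) conv_in_prob_add:
  assumes [measurable]: "\<And>n. Z n \<in> borel_measurable M" "\<And>n. W n \<in> borel_measurable M"
    and Z: "conv_in_prob M Z a" and W: "conv_in_prob M W b"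
  shows "conv_in_prob M (\<lambda>n \<omega>. Z n \<omega> + W n \<omega>) (a + b)"
  unfolding conv_in_prob_def
proof (intro allI impI)
  fix \<epsilon> :: real assume \<epsilon>: "0 < \<epsilon>"
  let ?A = "\<lambda>n. {\<omega>\<in>space M. \<epsilon> / 2 < \<bar>Z n \<omega> - a\<bar>}" and ?B = "\<lambda>n. {\<omega>\<in>space M. \<epsilon> / 2 < \<bar>W n \<omega> - b\<bar>}"
  have le: "measure M {\<omega>\<in>space M. \<epsilon> < \<bar>Z n \<omega> + W n \<omega> - (a + b)\<bar>} \<le> measure M (?A n) + measure M (?B n)" for n
  proof -
    have "measure M {\<omega>\<in>space M. \<epsilon> < \<bar>Z n \<omega> + W n \<omega> - (a + b)\<bar>} \<le> measure M (?A n \<union> ?B n)"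
    proof (rule finite_measure_mono)
      show "{\<omega>\<in>space M. \<epsilon> < \<bar>Z n \<omega> + W n \<omega> - (a + b)\<bar>} \<subseteq> ?A n \<union> ?B n"
      proof
        fix \<omega> assume "\<omega> \<in> {\<omega>\<in>space M. \<epsilon> < \<bar>Z n \<omega> + W n \<omega> - (a + b)\<bar>}"
        then have \<omega>: "\<omega> \<in> space M" "\<epsilon> < \<bar>Z n \<omega> + W n \<omega> - (a + b)\<bar>" by auto
        show "\<omega> \<in> ?A n \<union> ?B n"
        proof (rule ccontr)
          assume "\<omega> \<notin> ?A n \<union> ?B n"
          then have "\<bar>Z n \<omega> - a\<bar> \<le> \<epsilon> / 2" "\<bar>W n \<omega> - b\<bar> \<le> \<epsilon> / 2" using \<omega>(1) by auto
          then show False using \<omega>(2) by linarith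
        qed
      qed
    qed simp
    also have "\<dots> \<le> measure M (?A n) + measure M (?B n)" by (rule measure_Un_le) auto
    finally show ?thesis .
  qed
  have lim: "(\<lambda>n. measure M (?A n) + measure M (?B n)) \<longlonglongrightarrow> 0"
    using tendsto_add[OF conv_in_probD[OF Z] conv_in_probD[OF W], of "\<epsilon> / 2" "\<epsilon> / 2"] \<epsilon> by simp
  show "(\<lambda>n. measure M {\<omega>\<in>space M. \<epsilon> < \<bar>Z n \<omega> + W n \<omega> - (a + b)\<bar>}) \<longlonglongrightarrow> 0"
    by (rule real_tendsto_sandwich[OF always_eventually always_eventually tendsto_const lim])
      (rule allI, rule measure_nonneg, rule allI, rule le)
qed

lemma conv_in_prob_cmult:
  assumes "conv_in_prob M Z a" and k: "k \<noteq> 0"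
  shows "conv_in_prob M (\<lambda>n \<omega>. k * Z n \<omega>) (k * a)"
  unfolding conv_in_prob_def
proof (intro allI impI)
  fix \<epsilon> :: real assume "0 < \<epsilon>"
  then have "(\<lambda>n. measure M {\<omega>\<in>space M. \<epsilon> / \<bar>k\<bar> < \<bar>Z n \<omega> - a\<bar>}) \<longlonglongrightarrow> 0"
    using k by (intro conv_in_probD[OF assms(1)]) auto
  moreover have "\<epsilon> / \<bar>k\<bar> < \<bar>Z n \<omega> - a\<bar> \<longleftrightarrow> \<epsilon> < \<bar>k * Z n \<omega> - k * a\<bar>" for n \<omega>
  proof -
    have "\<bar>k * Z n \<omega> - k * a\<bar> = \<bar>Z n \<omega> - a\<bar> * \<bar>k\<bar>"
      by (metis abs_mult mult.commute right_diff_distrib)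
    then show ?thesis using k by (simp add: pos_divide_less_eq)
  qed
  ultimately show "(\<lambda>n. measure M {\<omega>\<in>space M. \<epsilon> < \<bar>k * Z n \<omega> - k * a\<bar>}) \<longlonglongrightarrow> 0"
    by (simp only:)
qed

text \<open>T is measure preserving, so the deviation events have equal probability. With T one of
  the projections \<open>fst\<close> and \<open>snd\<close>, this lifts convergence on M to the
  product \<open>M \<Otimes>\<^sub>M M\<close>.\<close>

lemma conv_in_prob_distr_iff:
  assumes [measurable]: "T \<in> measurable N M" "\<And>n. Z n \<in> borel_measurable M" and N: "distr N M T = M"
  shows "conv_in_prob N (\<lambda>n \<omega>. Z n (T \<omega>)) c \<longleftrightarrow> conv_in_prob M Z c"
proof -
  have "measure N {\<omega>\<in>space N. \<epsilon> < \<bar>Z n (T \<omega>) - c\<bar>} = measure M {\<omega>\<in>space M. \<epsilon> < \<bar>Z n \<omega> - c\<bar>}" for n \<epsilon>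
  proof -
    have "measure M {\<omega>\<in>space M. \<epsilon> < \<bar>Z n \<omega> - c\<bar>} = measure (distr N M T) {\<omega>\<in>space M. \<epsilon> < \<bar>Z n \<omega> - c\<bar>}"
      by (simp add: N)
    also have "\<dots> = measure N {\<omega>\<in>space N. \<epsilon> < \<bar>Z n (T \<omega>) - c\<bar>}"
      by (subst measure_distr) (auto intro!: arg_cong[where f="measure N"] dest: measurable_space[OF assms(1)])
    finally show ?thesis by simp
  qed
  then show ?thesis by (simp add: conv_in_prob_def)
qed

section \<open>Uniqueness of characteristic functions on product spaces\<close>

text \<open>Dividing w by its mass turns it into a probability density. Up to that mass, the
  integrals in the hypothesis are the characteristic function of X under the reweighted measure, so
  Levy's theorem identifies the two laws of X.\<close>

lemma integral_weighted_indicator_unique: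
  fixes w X :: "'a \<Rightarrow> real"
  assumes "prob_space P" "prob_space Q" and sets: "sets Q = sets P"
    and w[measurable]: "w \<in> borel_measurable P" and X[measurable]: "X \<in> borel_measurable P"
    and B: "B \<in> sets borel" and w0: "\<And>x. 0 \<le> w x" and wb: "\<And>x. w x \<le> b"
    and eq: "\<And>t. (\<integral>x. complex_of_real (w x) * iexp (t * X x) \<partial>P) = (\<integral>x. complex_of_real (w x) * iexp (t * X x) \<partial>Q)"
  shows "(\<integral>x. w x * indicator B (X x) \<partial>P) = (\<integral>x. w x * indicator B (X x) \<partial>Q)"
proof -
  define m where "m = (\<integral>x. w x \<partial>P)"
  \<comment> \<open>At t = 0 the hypothesis equates the masses of w under P and Q, so a single m
    normalizes both.\<close>
  have mQ': "(\<integral>x. w x \<partial>Q) = m"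
    using eq[of 0] by (simp add: m_def)
  have mnn: "0 \<le> m" unfolding m_def using w0 by (intro integral_nonneg_AE) auto
  have int: "integrable N w" if "prob_space N" "sets N = sets P" for N
  proof -
    interpret N: prob_space N by fact
    show ?thesis using that(2) w0 wb
      by (intro N.integrable_const_bound[of _ b]) (auto simp: measurable_cong_sets[OF that(2) refl])
  qed
  show ?thesis
  proof (cases "m = 0")
    \<comment> \<open>Normalization is impossible here, but w then vanishes almost everywhere and
      both integrals are 0.\<close>
    case True
    have "(\<integral>x. w x * indicator B (X x) \<partial>N) = 0" if N: "prob_space N" "sets N = sets P" "(\<integral>x. w x \<partial>N) = m" for N
    proof -
      have "AE x in N. w x = 0"
        using integral_nonneg_eq_0_iff_AE[OF int[OF N(1,2)]] w0 N(3) True by auto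
      then have "(\<integral>x. w x * indicator B (X x) \<partial>N) = (\<integral>x. 0 \<partial>N)"
        using N(2) B
        by (intro integral_cong_AE) (auto simp: measurable_cong_sets[OF N(2) refl])
      then show ?thesis by simp
    qed
    then show ?thesis using assms(1,2) sets mQ' m_def by metis
  next
    case False
    then have mpos: "0 < m" using mnn by simp
    define D where "D N = distr (density N (\<lambda>x. ennreal (w x / m))) borel X" for N
    have D: "real_distribution (D N)" "char (D N) t = (\<integral>x. complex_of_real (w x) * iexp (t * X x) \<partial>N) / m"
      "measure (D N) B = (\<integral>x. w x * indicator B (X x) \<partial>N) / m"
      if N: "prob_space N" "sets N = sets P" "(\<integral>x. w x \<partial>N) = m" for N t
    proof -
      note [measurable_cong] = N(2)
      have [measurable]: "X \<in> borel_measurable (density N (\<lambda>x. ennreal (w x / m)))" by simp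
      have "(\<integral>\<^sup>+x. ennreal (w x / m) \<partial>N) = ennreal (\<integral>x. w x / m \<partial>N)"
        using w0 mpos int[OF N(1,2)] by (intro nn_integral_eq_integral) auto
      also have "\<dots> = 1" using N(3) mpos by simp
      finally have "(\<integral>\<^sup>+x. ennreal (w x / m) * indicator (space N) x \<partial>N) = 1"
        by (subst nn_integral_cong[where v="\<lambda>x. ennreal (w x / m)"]) auto
      then have "prob_space (density N (\<lambda>x. ennreal (w x / m)))"
        by (intro prob_spaceI) (auto simp: emeasure_density)
      then show "real_distribution (D N)" unfolding D_def by (intro prob_space.real_distribution_distr) auto
      have "char (D N) t = (\<integral>x. (w x / m) *\<^sub>R iexp (t * X x) \<partial>N)"
        unfolding D_def char_def using w0 mpos by (subst integral_distr, simp, simp, subst integral_density) auto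
      also have "\<dots> = (\<integral>x. complex_of_real (w x) * iexp (t * X x) / m \<partial>N)"
        by (intro Bochner_Integration.integral_cong) (auto simp: scaleR_conv_of_real)
      finally show "char (D N) t = (\<integral>x. complex_of_real (w x) * iexp (t * X x) \<partial>N) / m" by simp
      have "measure (D N) B = (\<integral>x. indicator B x \<partial>D N)" using B by (simp add: D_def)
      also have "\<dots> = (\<integral>x. (w x / m) *\<^sub>R indicator B (X x) \<partial>N)"
        unfolding D_def using w0 mpos B by (subst integral_distr, simp, simp, subst integral_density) auto
      also have "\<dots> = (\<integral>x. w x * indicator B (X x) / m \<partial>N)" by simp
      finally show "measure (D N) B = (\<integral>x. w x * indicator B (X x) \<partial>N) / m" by simp
    qed
    have P: "prob_space P" "sets P = sets P" "(\<integral>x. w x \<partial>P) = m" using assms(1) m_def by auto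
    have Q: "prob_space Q" "sets Q = sets P" "(\<integral>x. w x \<partial>Q) = m" using assms(2) sets mQ' by auto
    have "char (D P) = char (D Q)" using D(2)[OF P] D(2)[OF Q] eq by (intro ext) simp
    then have "D P = D Q" using D(1)[OF P] D(1)[OF Q] Levy_uniqueness by blast
    then show ?thesis using D(3)[OF P] D(3)[OF Q] mpos by simp
  qed
qed

text \<open>The complex weight \<open>iexp S\<close> is a combination of the nonnegative weights \<open>1\<close>, \<open>1 + cos S\<close> and
  \<open>1 + sin S\<close>, to which Levy's uniqueness theorem applies.\<close>

lemma integral_weighted_iexp_indicator_unique:
  fixes v X S :: "'a \<Rightarrow> real"
  assumes P: "prob_space P" and Q: "prob_space Q" and sets: "sets Q = sets P"
    and v[measurable]: "v \<in> borel_measurable P" and X[measurable]: "X \<in> borel_measurable P"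
    and S[measurable]: "S \<in> borel_measurable P"
    and B: "B \<in> sets borel" and v0: "\<And>x. 0 \<le> v x" and v1: "\<And>x. v x \<le> 1"
    and eq: "\<And>t s. (\<integral>x. complex_of_real (v x) * iexp (t * X x + s * S x) \<partial>P) =
                  (\<integral>x. complex_of_real (v x) * iexp (t * X x + s * S x) \<partial>Q)"
  shows "(\<integral>x. complex_of_real (v x * indicator B (X x)) * iexp (S x) \<partial>P) =
         (\<integral>x. complex_of_real (v x * indicator B (X x)) * iexp (S x) \<partial>Q)"
proof -
  let ?e = "\<lambda>t s x. complex_of_real (v x) * iexp (t * X x + s * S x)"
  have meas: "f \<in> borel_measurable N" if "f \<in> borel_measurable P" "sets N = sets P"
    for N and f :: "'a \<Rightarrow> 'z::topological_space"
    using that by (simp add: measurable_cong_sets[OF that(2) refl])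
  have bnd: "integrable N f" if "prob_space N" "sets N = sets P" "f \<in> borel_measurable P" "\<And>x. norm (f x) \<le> b"
    for N b and f :: "'a \<Rightarrow> 'z::{banach,second_countable_topology}"
    using that meas by (intro finite_measure.integrable_const_bound[of N f b])
      (auto simp: prob_space.finite_measure)
  have e: "integrable N (?e t s)" if "prob_space N" "sets N = sets P" for N t s
    using v0 v1 by (intro bnd[of _ _ 1] that) (auto simp: norm_mult)
  \<comment> \<open>Euler's formulas: each trigonometric weight times the phase
    \<open>iexp (t * a)\<close> combines the phases with s = 0, 1, -1, and the integrals of these
    are what \<open>eq\<close> equates.\<close>
  have pc: "complex_of_real r * iexp (t * a + 0 * b) + complex_of_real r * iexp (t * a + 1 * b) / 2 +
      complex_of_real r * iexp (t * a + (-1) * b) / 2 = complex_of_real (r * (1 + cos b)) * iexp (t * a)"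
    and ps: "complex_of_real r * iexp (t * a + 0 * b) + complex_of_real r * iexp (t * a + 1 * b) / (2 * \<i>) -
      complex_of_real r * iexp (t * a + (-1) * b) / (2 * \<i>) = complex_of_real (r * (1 + sin b)) * iexp (t * a)"
    for r t a b :: real
    unfolding cis_conv_exp[symmetric]
    by (simp_all add: complex_eq_iff Re_divide Im_divide cos_add sin_add cos_diff sin_diff power2_eq_square diff_divide_distrib add_divide_distrib algebra_simps)
  \<comment> \<open>Subtracting the weight 1 from 1 + cos and 1 + sin leaves cos b + i sin b, the
    desired complex weight.\<close>
  have ind: "complex_of_real (r * (1 + cos b) * i - r * i) + \<i> * complex_of_real (r * (1 + sin b) * i - r * i) =
      complex_of_real (r * i) * iexp b" for r i b :: real
    unfolding cis_conv_exp[symmetric] by (simp add: complex_eq_iff algebra_simps)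
  have C: "(\<integral>x. complex_of_real (v x * (1 + cos (S x))) * iexp (t * X x) \<partial>N) =
      (\<integral>x. ?e t 0 x \<partial>N) + (\<integral>x. ?e t 1 x \<partial>N) / 2 + (\<integral>x. ?e t (-1) x \<partial>N) / 2"
    and Sn: "(\<integral>x. complex_of_real (v x * (1 + sin (S x))) * iexp (t * X x) \<partial>N) =
      (\<integral>x. ?e t 0 x \<partial>N) + (\<integral>x. ?e t 1 x \<partial>N) / (2 * \<i>) - (\<integral>x. ?e t (-1) x \<partial>N) / (2 * \<i>)"
    if N: "prob_space N" "sets N = sets P" for N t
  proof -
    note e = e[OF N]
    have "(\<integral>x. ?e t 0 x \<partial>N) + (\<integral>x. ?e t 1 x \<partial>N) / 2 + (\<integral>x. ?e t (-1) x \<partial>N) / 2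
        = (\<integral>x. ?e t 0 x + ?e t 1 x / 2 + ?e t (-1) x / 2 \<partial>N)"
      using e[of t 0] e[of t 1] e[of t "-1"] by simp
    also have "\<dots> = (\<integral>x. complex_of_real (v x * (1 + cos (S x))) * iexp (t * X x) \<partial>N)"
      by (simp only: pc)
    finally show "(\<integral>x. complex_of_real (v x * (1 + cos (S x))) * iexp (t * X x) \<partial>N) =
      (\<integral>x. ?e t 0 x \<partial>N) + (\<integral>x. ?e t 1 x \<partial>N) / 2 + (\<integral>x. ?e t (-1) x \<partial>N) / 2" by simp
    have "(\<integral>x. ?e t 0 x \<partial>N) + (\<integral>x. ?e t 1 x \<partial>N) / (2 * \<i>) - (\<integral>x. ?e t (-1) x \<partial>N) / (2 * \<i>)
        = (\<integral>x. ?e t 0 x + ?e t 1 x / (2 * \<i>) - ?e t (-1) x / (2 * \<i>) \<partial>N)"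
      using e[of t 0] e[of t 1] e[of t "-1"] by simp
    also have "\<dots> = (\<integral>x. complex_of_real (v x * (1 + sin (S x))) * iexp (t * X x) \<partial>N)"
      by (simp only: ps)
    finally show "(\<integral>x. complex_of_real (v x * (1 + sin (S x))) * iexp (t * X x) \<partial>N) =
      (\<integral>x. ?e t 0 x \<partial>N) + (\<integral>x. ?e t 1 x \<partial>N) / (2 * \<i>) - (\<integral>x. ?e t (-1) x \<partial>N) / (2 * \<i>)" by simp
  qed
  define weights where "weights = {v, (\<lambda>x. v x * (1 + cos (S x))), (\<lambda>x. v x * (1 + sin (S x)))}"
  have weights: "0 \<le> w x" "w x \<le> 2" "w \<in> borel_measurable P" if "w \<in> weights" for w x
  proof -
    have 1: "0 \<le> 1 + cos y" "0 \<le> 1 + sin y" "1 + cos y \<le> 2" "1 + sin y \<le> 2" for y :: real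
      using cos_ge_minus_one[of y] sin_ge_minus_one[of y] cos_le_one[of y] sin_le_one[of y] by linarith+
    show "0 \<le> w x" "w \<in> borel_measurable P" using that v0[of x] 1 by (auto simp: weights_def)
    show "w x \<le> 2"
      using that v1[of x] mult_mono[OF v1[of x] 1(3)[of "S x"]] mult_mono[OF v1[of x] 1(4)[of "S x"]] 1
      by (auto simp: weights_def)
  qed
  have w: "(\<integral>x. w x * indicator B (X x) \<partial>P) = (\<integral>x. w x * indicator B (X x) \<partial>Q)"
    if "w \<in> weights" for w
  proof (rule integral_weighted_indicator_unique[OF P Q sets weights(3)[OF that] X B weights(1,2)[OF that]])
    show "(\<integral>x. complex_of_real (w x) * iexp (t * X x) \<partial>P) = (\<integral>x. complex_of_real (w x) * iexp (t * X x) \<partial>Q)" for t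
      using that unfolding weights_def insert_iff empty_iff
    proof (elim disjE FalseE)
      assume "w = v" then show ?thesis using eq[of t 0] by simp
    qed (simp_all only: C[OF P refl] C[OF Q sets] Sn[OF P refl] Sn[OF Q sets] eq)
  qed
  have split: "(\<integral>x. complex_of_real (v x * indicator B (X x)) * iexp (S x) \<partial>N) =
      complex_of_real ((\<integral>x. v x * (1 + cos (S x)) * indicator B (X x) \<partial>N) - (\<integral>x. v x * indicator B (X x) \<partial>N)) +
      \<i> * complex_of_real ((\<integral>x. v x * (1 + sin (S x)) * indicator B (X x) \<partial>N) - (\<integral>x. v x * indicator B (X x) \<partial>N))"
    if N: "prob_space N" "sets N = sets P" for N
  proof -
    have i: "integrable N (\<lambda>x. w x * indicator B (X x))" if "w \<in> weights" for w
      using B weights[OF that]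
      by (intro bnd[of _ _ 2] N borel_measurable_times) (auto simp: indicator_def)
    have cplx: "complex_of_real ((\<integral>x. f x \<partial>N) - (\<integral>x. h x \<partial>N)) + \<i> * complex_of_real ((\<integral>x. g x \<partial>N) - (\<integral>x. h x \<partial>N)) =
        (\<integral>x. complex_of_real (f x - h x) + \<i> * complex_of_real (g x - h x) \<partial>N)"
      if "integrable N f" "integrable N g" "integrable N h" for f g h :: "'a \<Rightarrow> real"
      using that by simp
    have "complex_of_real ((\<integral>x. v x * (1 + cos (S x)) * indicator B (X x) \<partial>N) - (\<integral>x. v x * indicator B (X x) \<partial>N)) +
      \<i> * complex_of_real ((\<integral>x. v x * (1 + sin (S x)) * indicator B (X x) \<partial>N) - (\<integral>x. v x * indicator B (X x) \<partial>N))
      = (\<integral>x. complex_of_real (v x * (1 + cos (S x)) * indicator B (X x) - v x * indicator B (X x)) +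
          \<i> * complex_of_real (v x * (1 + sin (S x)) * indicator B (X x) - v x * indicator B (X x)) \<partial>N)"
      by (intro cplx i) (auto simp: weights_def)
    also have "\<dots> = (\<integral>x. complex_of_real (v x * indicator B (X x)) * iexp (S x) \<partial>N)"
      by (intro Bochner_Integration.integral_cong)
        (simp_all only: ind)
    finally show ?thesis by simp
  qed
  show ?thesis unfolding split[OF P refl] split[OF Q sets]
    using w[of v] w[of "\<lambda>x. v x * (1 + cos (S x))"] w[of "\<lambda>x. v x * (1 + sin (S x))"]
    by (simp add: weights_def)
qed

text \<open>The one-dimensional uniqueness theorem is applied to one coordinate at a time. After all
  d exchanges no phase is left, and the identity equates the two measures on boxes, an
  intersection-stable generator.\<close>

lemma PiM_char_uniqueness:
  assumes P: "prob_space P" and Q: "prob_space Q"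
    and sP: "sets P = sets (lborel_vec d)" and sQ: "sets Q = sets (lborel_vec d)"
    and char_eq: "\<And>u. (\<integral>x. iexp (dot d u x) \<partial>P) = (\<integral>x. iexp (dot d u x) \<partial>Q)"
  shows "P = Q"
proof -
  interpret P: prob_space P by (rule P)
  interpret Q: prob_space Q by (rule Q)
  note [measurable_cong] = sP sQ
  let ?v = "\<lambda>A k x. \<Prod>j<k. indicator (A j) (x j) :: real"
  have v0: "0 \<le> ?v A k x" and v1: "?v A k x \<le> 1" for A :: "nat \<Rightarrow> real set" and k x
    by (auto intro!: prod_nonneg prod_le_1)
  have v[measurable]: "?v A k \<in> borel_measurable P"
    if "k \<le> d" "\<And>j. j < d \<Longrightarrow> A j \<in> sets borel" for A :: "nat \<Rightarrow> real set" and k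
    using that by (intro borel_measurable_prod) (auto intro!: borel_measurable_indicator' simp: measurable_cong_sets[OF sP refl])
  \<comment> \<open>Coordinate by coordinate, the factor \<open>iexp (u\<^sub>k x\<^sub>k)\<close> is traded for an indicator of \<open>x\<^sub>k\<close>.\<close>
  have claim: "(\<integral>x. complex_of_real (?v A k x) * iexp (\<Sum>j\<in>{k..<d}. u j * x j) \<partial>P) =
      (\<integral>x. complex_of_real (?v A k x) * iexp (\<Sum>j\<in>{k..<d}. u j * x j) \<partial>Q)"
    if "k \<le> d" "\<And>j. j < d \<Longrightarrow> A j \<in> sets borel" for A :: "nat \<Rightarrow> real set" and k and u :: "nat \<Rightarrow> real"
    using that(1)
  proof (induction k arbitrary: u)
    case 0
    then show ?case using char_eq[of u] by (simp add: dot_def atLeast0LessThan)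
  next
    case (Suc k)
    have "(\<integral>x. complex_of_real (?v A k x * indicator (A k) (x k)) * iexp (\<Sum>j\<in>{Suc k..<d}. u j * x j) \<partial>P) =
      (\<integral>x. complex_of_real (?v A k x * indicator (A k) (x k)) * iexp (\<Sum>j\<in>{Suc k..<d}. u j * x j) \<partial>Q)"
    proof (rule integral_weighted_iexp_indicator_unique[OF P Q _ v])
      fix t s :: real
      \<comment> \<open>Coordinate k receives its own frequency t and the later ones are scaled by
        s. The result is again a frequency vector, which is why the induction keeps u
        arbitrary.\<close>
      have "t * x k + s * (\<Sum>j\<in>{Suc k..<d}. u j * x j) =
          (\<Sum>j\<in>{k..<d}. (if j = k then t else s * u j) * x j)" for x :: "nat \<Rightarrow> real"
      proof -
        have "{k..<d} = insert k {Suc k..<d}" using Suc.prems by auto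
        then show ?thesis by (simp add: sum_distrib_left mult.assoc)
      qed
      then show "(\<integral>x. complex_of_real (?v A k x) * iexp (t * x k + s * (\<Sum>j\<in>{Suc k..<d}. u j * x j)) \<partial>P) =
        (\<integral>x. complex_of_real (?v A k x) * iexp (t * x k + s * (\<Sum>j\<in>{Suc k..<d}. u j * x j)) \<partial>Q)"
        using Suc.IH[of "\<lambda>j. if j = k then t else s * u j"] Suc.prems by (simp only:)
    next
      show "(\<lambda>x. x k) \<in> borel_measurable P" "(\<lambda>x. \<Sum>j\<in>{Suc k..<d}. u j * x j) \<in> borel_measurable P"
        using Suc.prems by (auto simp: measurable_cong_sets[OF sP refl] intro!: borel_measurable_sum borel_measurable_times)
    qed (use Suc.prems that(2) v0 v1 sP sQ in auto)
    then show ?case by (simp add: lessThan_Suc mult_ac)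
  qed
  show ?thesis
  proof (rule measure_eqI_PiM_finite[OF _ sP sQ])
    fix A :: "nat \<Rightarrow> real set" assume "\<And>i. i \<in> {..<d} \<Longrightarrow> A i \<in> sets lborel"
    then have A: "\<And>j. j < d \<Longrightarrow> A j \<in> sets borel" by simp
    have ind: "indicator (Pi\<^sub>E {..<d} A) x = ?v A d x" if "x \<in> space (lborel_vec d)" for x
      using that by (auto simp: indicator_def space_PiM PiE_iff)
    have box: "Pi\<^sub>E {..<d} A \<in> sets (lborel_vec d)" using A by (intro sets_PiM_I_finite) auto
    have m: "measure N (Pi\<^sub>E {..<d} A) = (\<integral>x. ?v A d x \<partial>N)" if "sets N = sets (lborel_vec d)" for N
    proof -
      have "measure N (Pi\<^sub>E {..<d} A) = (\<integral>x. indicator (Pi\<^sub>E {..<d} A) x \<partial>N)"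
        using box sets.sets_into_space[OF box] sets_eq_imp_space_eq[OF that]
        by (simp add: that Int_absorb2)
      also have "\<dots> = (\<integral>x. ?v A d x \<partial>N)"
        using sets_eq_imp_space_eq[OF that] by (intro Bochner_Integration.integral_cong ind) auto
      finally show ?thesis .
    qed
    have "complex_of_real (\<integral>x. ?v A d x \<partial>P) = complex_of_real (\<integral>x. ?v A d x \<partial>Q)"
      using claim[of d A] A by (simp del: of_real_prod flip: integral_complex_of_real)
    then show "emeasure P (Pi\<^sub>E {..<d} A) = emeasure Q (Pi\<^sub>E {..<d} A)"
      using m[OF sP] m[OF sQ] by (simp add: P.emeasure_eq_measure Q.emeasure_eq_measure)
  next
    \<comment> \<open>The whole space is itself a box of finite mass, so a constant sequence
      exhausts it.\<close>
    show "range (\<lambda>_::nat. space (lborel_vec d)) \<subseteq> prod_algebra {..<d} (\<lambda>_. lborel)"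
      by (auto simp: space_PiM intro!: prod_algebraI_finite)
  qed auto
qed

section \<open>The isotropic normal distribution\<close>

text \<open>Substituting s * x for x reduces the integral to the standard normal characteristic
  function at s * t.\<close>

lemma char_normal_density:
  assumes "0 < s"
  shows "(\<integral>x. normal_density 0 s x *\<^sub>R iexp (t * x) \<partial>lborel) = exp (- (s * t)\<^sup>2 / 2)"
proof -
  have "(\<integral>x. normal_density 0 s x *\<^sub>R iexp (t * x) \<partial>lborel) =
      s *\<^sub>R (\<integral>x. normal_density 0 s (s * x) *\<^sub>R iexp (t * (s * x)) \<partial>lborel)"
    using assms by (subst lborel_integral_real_affine[of s _ 0]) auto
  also have "\<dots> = (\<integral>x. s *\<^sub>R (normal_density 0 s (s * x) *\<^sub>R iexp (t * (s * x))) \<partial>lborel)"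
    by (simp only: integral_scaleR_right)
  also have "\<dots> = (\<integral>x. std_normal_density x *\<^sub>R iexp (s * t * x) \<partial>lborel)"
    using assms
    by (intro Bochner_Integration.integral_cong)
      (auto simp: normal_density_def power_mult_distrib real_sqrt_mult mult_ac)
  also have "\<dots> = char std_normal_distribution (s * t)"
    unfolding char_def by (subst integral_density) auto
  also have "\<dots> = exp (- (s * t)\<^sup>2 / 2)" by (simp add: char_std_normal_distribution)
  finally show ?thesis .
qed

text \<open>The squared norm is a sum over coordinates. The factorization reduces total mass and
  characteristic function to one-dimensional integrals.\<close>

lemma isotropic_normal_density_eq_prod:
  assumes "0 < s"
  shows "isotropic_normal_density d s x = (\<Prod>i<d. normal_density 0 s (x i))"
proof -
  have "(\<Prod>i<d. normal_density 0 s (x i)) = (1 / sqrt (2 * pi * s\<^sup>2)) ^ d * exp (\<Sum>i<d. - (x i)\<^sup>2 / (2 * s\<^sup>2))"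
    unfolding normal_density_def by (simp only: prod.distrib exp_sum[OF finite_lessThan] prod_constant card_lessThan) simp
  also have "(1 / sqrt (2 * pi * s\<^sup>2)) ^ d = (2 * pi * s\<^sup>2) powr (- real d / 2)"
  proof -
    define y where "y = 2 * pi * s\<^sup>2"
    have "0 < y" using assms by (simp add: y_def)
    then have "1 / sqrt y = y powr (- 1 / 2)" by (simp add: powr_minus_divide powr_half_sqrt)
    then have "(1 / sqrt y) ^ d = y powr (- 1 / 2 * real d)" using \<open>0 < y\<close> by (simp only: powr_power) simp
    then show ?thesis by (simp add: y_def)
  qed
  also have "(\<Sum>i<d. - (x i)\<^sup>2 / (2 * s\<^sup>2)) = - (L2_set x {..<d})\<^sup>2 / (2 * s\<^sup>2)"
    by (simp add: L2_set_def sum_nonneg sum_divide_distrib sum_negf)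
  finally show ?thesis by (simp add: isotropic_normal_density_def)
qed

lemma isotropic_normal_density_nonneg [simp]: "0 \<le> isotropic_normal_density d s x"
  by (simp add: isotropic_normal_density_def)

lemma borel_measurable_isotropic_normal_density [measurable]:
  "isotropic_normal_density d s \<in> borel_measurable (lborel_vec d)"
  unfolding isotropic_normal_density_def L2_set_def by measurable

interpretation lborel_product: product_sigma_finite "\<lambda>_::nat. lborel :: real measure" ..

lemma prob_space_isotropic_normal:
  assumes "0 < s"
  shows "prob_space (density (lborel_vec d) (\<lambda>x. ennreal (isotropic_normal_density d s x)))"
proof (rule prob_spaceI)
  have "emeasure (density (lborel_vec d) (\<lambda>x. ennreal (isotropic_normal_density d s x))) (space (lborel_vec d)) =
      (\<integral>\<^sup>+x. ennreal (isotropic_normal_density d s x) * indicator (space (lborel_vec d)) x \<partial>lborel_vec d)"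
    by (subst emeasure_density) auto
  also have "\<dots> = (\<integral>\<^sup>+x. (\<Prod>i<d. ennreal (normal_density 0 s (x i))) \<partial>lborel_vec d)"
    using assms by (intro nn_integral_cong) (auto simp: isotropic_normal_density_eq_prod prod_ennreal)
  also have "\<dots> = (\<Prod>i<d. \<integral>\<^sup>+x. ennreal (normal_density 0 s x) \<partial>lborel)"
    by (subst lborel_product.product_nn_integral_prod) auto
  also have "\<dots> = 1"
    using prob_space.emeasure_space_1[OF prob_space_normal_density[OF assms, of 0]]
    by (simp add: emeasure_density)
  finally show "emeasure (density (lborel_vec d) (\<lambda>x. ennreal (isotropic_normal_density d s x)))
      (space (density (lborel_vec d) (\<lambda>x. ennreal (isotropic_normal_density d s x)))) = 1" by simp
qed

lemma char_isotropic_normal: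
  assumes "0 < s"
  shows "(\<integral>x. iexp (dot d u x) \<partial>density (lborel_vec d) (\<lambda>x. ennreal (isotropic_normal_density d s x))) =
    complex_of_real (exp (- (s\<^sup>2 / 2) * (L2_set u {..<d})\<^sup>2))"
proof -
  have [measurable]: "(\<lambda>x. iexp (dot d u x)) \<in> borel_measurable (lborel_vec d)"
    unfolding dot_def by measurable
  have "(\<integral>x. iexp (dot d u x) \<partial>density (lborel_vec d) (\<lambda>x. ennreal (isotropic_normal_density d s x))) =
      (\<integral>x. (\<Prod>i<d. normal_density 0 s (x i) *\<^sub>R iexp (u i * x i)) \<partial>lborel_vec d)"
    using assms
    by (subst integral_density)
      (auto simp: isotropic_normal_density_eq_prod dot_def scaleR_conv_of_real prod.distrib exp_sum
        sum_distrib_left intro!: prod_nonneg AE_I2)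
  also have "\<dots> = (\<Prod>i<d. \<integral>x. normal_density 0 s x *\<^sub>R iexp (u i * x) \<partial>lborel)"
  proof (rule lborel_product.product_integral_prod)
    show "integrable lborel (\<lambda>x. normal_density 0 s x *\<^sub>R iexp (u i * x))" for i
      by (rule Bochner_Integration.integrable_bound[OF integrable_normal_density[OF assms, of 0]]) auto
  qed simp
  also have "\<dots> = complex_of_real (exp (\<Sum>i<d. - (s * u i)\<^sup>2 / 2))"
    by (simp only: char_normal_density[OF assms] exp_sum[OF finite_lessThan] of_real_prod)
  also have "(\<Sum>i<d. - (s * u i)\<^sup>2 / 2) = - (s\<^sup>2 / 2) * (L2_set u {..<d})\<^sup>2"
    by (simp add: L2_set_def sum_nonneg sum_divide_distrib sum_negf sum_distrib_left power_mult_distrib)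
  finally show ?thesis .
qed

section \<open>Conditional characteristic functions\<close>

text \<open>Independence makes the joint law a product, and boundedness supplies the integrability
  for Fubini. The inner integral runs over a fresh sample point, so V acts there as an independent
  copy.\<close>

lemma (in prob_space) integral_indep_var_pair:
  fixes F :: "'b \<times> 'b \<Rightarrow> 'd::{banach, second_countable_topology}"
  assumes indep: "indep_var S U T V"
    and F[measurable]: "F \<in> borel_measurable (S \<Otimes>\<^sub>M T)" and bound: "\<And>p. norm (F p) \<le> b"
  shows "(\<integral>\<omega>. F (U \<omega>, V \<omega>) \<partial>M) = (\<integral>\<omega>. (\<integral>\<omega>'. F (U \<omega>, V \<omega>') \<partial>M) \<partial>M)"
proof -
  have U[measurable]: "U \<in> measurable M S" and V[measurable]: "V \<in> measurable M T"
    using indep_var_rv1[OF indep] indep_var_rv2[OF indep] by auto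
  interpret U: prob_space "distr M S U" by (rule prob_space_distr) fact
  interpret V: prob_space "distr M T V" by (rule prob_space_distr) fact
  interpret UV: pair_prob_space "distr M S U" "distr M T V" ..
  have "(\<integral>\<omega>. F (U \<omega>, V \<omega>) \<partial>M) = (\<integral>p. F p \<partial>distr M (S \<Otimes>\<^sub>M T) (\<lambda>\<omega>. (U \<omega>, V \<omega>)))"
    by (subst integral_distr) auto
  also have "\<dots> = (\<integral>p. F p \<partial>(distr M S U \<Otimes>\<^sub>M distr M T V))"
    using indep by (simp add: indep_var_distribution_eq)
  also have "\<dots> = (\<integral>x. (\<integral>y. F (x, y) \<partial>distr M T V) \<partial>distr M S U)"
    by (rule UV.integral_fst'[symmetric], rule UV.integrable_const_bound[of _ b]) (auto simp: bound)
  also have "\<dots> = (\<integral>\<omega>. (\<integral>\<omega>'. F (U \<omega>, V \<omega>') \<partial>M) \<partial>M)"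
    by (subst integral_distr, simp, simp, intro Bochner_Integration.integral_cong refl integral_distr) 
      (auto dest: measurable_space[OF U])
  finally show ?thesis .
qed

text \<open>This is the freezing principle. An event of the generated \<sigma>-algebra is a preimage
  under U, so its indicator can be absorbed into the integrand as a function of the first argument;
  \<open>integral_indep_var_pair\<close> then gives the defining identity of the conditional
  expectation.\<close>

lemma (in prob_space) real_cond_exp_indep_var:
  fixes F :: "'b \<times> 'b \<Rightarrow> real"
  assumes indep: "indep_var S U T V"
    and F[measurable]: "F \<in> borel_measurable (S \<Otimes>\<^sub>M T)" and bound: "\<And>p. norm (F p) \<le> b"
  shows "AE \<omega> in M. real_cond_exp M (vimage_algebra (space M) U S) (\<lambda>\<omega>. F (U \<omega>, V \<omega>)) \<omega>
    = (\<integral>\<omega>'. F (U \<omega>, V \<omega>') \<partial>M)"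
proof -
  have U[measurable]: "U \<in> measurable M S" and V[measurable]: "V \<in> measurable M T"
    using indep_var_rv1[OF indep] indep_var_rv2[OF indep] by auto
  have US: "U \<in> space M \<rightarrow> space S" using measurable_space[OF U] by auto
  let ?F = "vimage_algebra (space M) U S"
  interpret finite_measure_subalgebra M ?F
    by unfold_locales (auto simp: subalgebra_def sets_vimage_algebra2[OF US])
  have b: "0 \<le> b" using bound[of undefined] norm_ge_zero order_trans by blast
  have G: "(\<lambda>x. \<integral>\<omega>'. F (x, V \<omega>') \<partial>M) \<in> borel_measurable S" by measurable
  show ?thesis
  proof (rule real_cond_exp_charact)
    show "integrable M (\<lambda>\<omega>. F (U \<omega>, V \<omega>))"
      using bound by (intro integrable_const_bound[of _ b]) auto
    have "norm (\<integral>\<omega>'. F (x, V \<omega>') \<partial>M) \<le> b" for x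
    proof -
      have "norm (\<integral>\<omega>'. F (x, V \<omega>') \<partial>M) \<le> (\<integral>\<omega>'. norm (F (x, V \<omega>')) \<partial>M)" by (rule integral_norm_bound)
      also have "\<dots> \<le> (\<integral>\<omega>'. b \<partial>M)" by (rule Bochner_Integration.integral_mono') (use bound b in auto)
      finally show ?thesis by (simp add: prob_space)
    qed
    then show "integrable M (\<lambda>\<omega>. \<integral>\<omega>'. F (U \<omega>, V \<omega>') \<partial>M)"
      by (intro integrable_const_bound[of _ b]) auto
    show "(\<lambda>\<omega>. \<integral>\<omega>'. F (U \<omega>, V \<omega>') \<partial>M) \<in> borel_measurable ?F"
      by (rule measurable_compose[OF measurable_vimage_algebra1[OF US] G])
  next
    fix A assume "A \<in> sets ?F"
    then obtain B where B[measurable]: "B \<in> sets S" and A: "A = U -` B \<inter> space M"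
      unfolding sets_vimage_algebra2[OF US] by auto
    have iA: "indicat_real A \<omega> = indicator B (U \<omega>)" if "\<omega> \<in> space M" for \<omega>
      using that by (auto simp: A indicator_def)
    have "(\<integral>\<omega>\<in>A. F (U \<omega>, V \<omega>) \<partial>M) = (\<integral>\<omega>. (case (U \<omega>, V \<omega>) of (x, y) \<Rightarrow> indicator B x * F (x, y)) \<partial>M)"
      unfolding set_lebesgue_integral_def by (intro Bochner_Integration.integral_cong) (auto simp: iA)
    also have "\<dots> = (\<integral>\<omega>. (\<integral>\<omega>'. (case (U \<omega>, V \<omega>') of (x, y) \<Rightarrow> indicator B x * F (x, y)) \<partial>M) \<partial>M)"
      using bound b by (intro integral_indep_var_pair[OF indep, where b=b]) (auto simp: abs_mult indicator_def)
    also have "\<dots> = (\<integral>\<omega>\<in>A. (\<integral>\<omega>'. F (U \<omega>, V \<omega>') \<partial>M) \<partial>M)"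
      unfolding set_lebesgue_integral_def by (intro Bochner_Integration.integral_cong) (auto simp: iA)
    finally show "(\<integral>\<omega>\<in>A. F (U \<omega>, V \<omega>) \<partial>M) = (\<integral>\<omega>\<in>A. (\<integral>\<omega>'. F (U \<omega>, V \<omega>') \<partial>M) \<partial>M)" .
  qed
qed

lemma borel_measurable_Complex [measurable]:
  assumes [measurable]: "f \<in> borel_measurable N" "g \<in> borel_measurable N"
  shows "(\<lambda>x. Complex (f x) (g x)) \<in> borel_measurable N"
  unfolding Complex_eq by measurable

lemma borel_measurable_cond_char [measurable]: "cond_char M S U Y t \<in> borel_measurable M"
  unfolding cond_char_def complex_cond_exp_def by measurable

lemma measurable_dot_compose [measurable (raw)]:
  assumes "U \<in> measurable N (lborel_vec d)" "V \<in> measurable N (lborel_vec d)"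
  shows "(\<lambda>\<omega>. dot d (U \<omega>) (V \<omega>)) \<in> borel_measurable N"
  using measurable_compose[OF measurable_Pair[OF assms] measurable_dot] by simp

text \<open>The complex conditional expectation is componentwise, so freezing is applied to cos and
  sin separately and the two parts are reassembled.\<close>

lemma (in prob_space) cond_char_dot:
  assumes indep: "indep_var (lborel_vec d) U (lborel_vec d) V"
  shows "AE \<omega> in M. cond_char M (lborel_vec d) U (\<lambda>\<omega>. dot d (U \<omega>) (V \<omega>)) t \<omega> =
    (\<integral>\<omega>'. iexp (t * dot d (U \<omega>) (V \<omega>')) \<partial>M)"
proof -
  have U[measurable]: "U \<in> measurable M (lborel_vec d)" and V[measurable]: "V \<in> measurable M (lborel_vec d)"
    using indep_var_rv1[OF indep] indep_var_rv2[OF indep] by auto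
  have "AE \<omega> in M. real_cond_exp M (vimage_algebra (space M) U (lborel_vec d))
        (\<lambda>\<omega>. (\<lambda>(x, y). g (t * dot d x y)) (U \<omega>, V \<omega>)) \<omega> =
      (\<integral>\<omega>'. (\<lambda>(x, y). g (t * dot d x y)) (U \<omega>, V \<omega>') \<partial>M)"
    if [measurable]: "g \<in> borel_measurable borel" and "\<And>y. \<bar>g y\<bar> \<le> 1" for g :: "real \<Rightarrow> real"
    using that(2) by (intro real_cond_exp_indep_var[OF indep, where b=1]) auto
  note AE = this
  have "(cos :: real \<Rightarrow> real) \<in> borel_measurable borel" "(sin :: real \<Rightarrow> real) \<in> borel_measurable borel"
    by measurable
  from AE[OF this(1) abs_cos_le_one] AE[OF this(2) abs_sin_le_one] show ?thesis
    using AE_space[of M]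
  proof eventually_elim
    case (elim \<omega>)
    let ?f = "\<lambda>\<omega>'. iexp (t * dot d (U \<omega>) (V \<omega>'))"
    have int: "complex_integrable M ?f"
      using measurable_space[OF U elim(3)] by (intro integrable_iexp) auto
    have ReIm: "Re (iexp y) = cos y" "Im (iexp y) = sin y" for y :: real by (simp_all flip: cis_conv_exp)
    have "(\<integral>\<omega>'. cos (t * dot d (U \<omega>) (V \<omega>')) \<partial>M) = Re (\<integral>\<omega>'. ?f \<omega>' \<partial>M)"
      "(\<integral>\<omega>'. sin (t * dot d (U \<omega>) (V \<omega>')) \<partial>M) = Im (\<integral>\<omega>'. ?f \<omega>' \<partial>M)"
      unfolding integral_Re[OF int, symmetric] integral_Im[OF int, symmetric] ReIm by simp_all
    then show ?case
      using elim(1,2) by (simp add: cond_char_def complex_cond_exp_def ReIm complex_eq_iff del: of_real_mult)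
  qed
qed

section \<open>Euclidean algebra of \<open>dot\<close> and \<open>L2_set\<close>\<close>

lemma dot_commute: "dot d x y = dot d y x"
  by (simp add: dot_def mult.commute)

lemma dot_scale_left: "dot d (\<lambda>i. c * x i) y = c * dot d x y"
  by (simp add: dot_def sum_distrib_left mult.assoc)

lemma dot_diff_left: "dot d (\<lambda>i. x i - y i) z = dot d x z - dot d y z"
  by (simp add: dot_def left_diff_distrib sum_subtractf)

lemma dot_self: "dot d x x = (L2_set x {..<d})\<^sup>2"
  by (simp add: dot_def L2_set_def sum_nonneg power2_eq_square[symmetric])

lemma L2_set_scale_power2: "(L2_set (\<lambda>i. c * x i) {..<d})\<^sup>2 = c\<^sup>2 * (L2_set x {..<d})\<^sup>2"
  by (simp add: L2_set_def sum_nonneg sum_distrib_left power_mult_distrib)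

lemma L2_set_diff_power2: "(L2_set (\<lambda>i. x i - y i) {..<d})\<^sup>2
    = (L2_set x {..<d})\<^sup>2 + (L2_set y {..<d})\<^sup>2 - 2 * dot d x y"
  by (simp add: dot_self[symmetric] dot_def sum.distrib[symmetric] sum_subtractf[symmetric] sum_distrib_left
      algebra_simps)

text \<open>By freezing, the conditional characteristic function is
  \<open>\<phi> (U \<omega>)\<close>. Its squared modulus is \<phi> times its conjugate, a double
  integral whose phase involves the difference of two independent copies of V. Fubini then
  integrates over U first, which turns each phase into \<psi> of a squared norm.\<close>

lemma (in prob_space) var_cond_char_dot:
  fixes \<psi> :: "real \<Rightarrow> real"
  assumes indep: "indep_var (lborel_vec d) U (lborel_vec d) V"
    and char: "\<And>u. (\<integral>\<omega>. iexp (dot d u (U \<omega>)) \<partial>M) = complex_of_real (\<psi> ((L2_set u {..<d})\<^sup>2))"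
  shows "var_cond_char M (lborel_vec d) U (\<lambda>\<omega>. dot d (U \<omega>) (V \<omega>)) t =
    (\<integral>(\<omega>, \<omega>'). \<psi> (t\<^sup>2 * (L2_set (\<lambda>i. V \<omega> i - V \<omega>' i) {..<d})\<^sup>2) \<partial>(M \<Otimes>\<^sub>M M)) -
    (\<integral>\<omega>. \<psi> (t\<^sup>2 * (L2_set (V \<omega>) {..<d})\<^sup>2) \<partial>M)\<^sup>2"
proof -
  have U[measurable]: "U \<in> measurable M (lborel_vec d)" and V[measurable]: "V \<in> measurable M (lborel_vec d)"
    using indep_var_rv1[OF indep] indep_var_rv2[OF indep] by auto
  interpret MM: pair_prob_space M M ..
  interpret MMM: pair_prob_space M "M \<Otimes>\<^sub>M M" ..
  define \<phi> where "\<phi> x = (\<integral>\<omega>'. iexp (t * dot d x (V \<omega>')) \<partial>M)" for x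
  have AE: "AE \<omega> in M. cond_char M (lborel_vec d) U (\<lambda>\<omega>. dot d (U \<omega>) (V \<omega>)) t \<omega> = \<phi> (U \<omega>)"
    unfolding \<phi>_def by (rule cond_char_dot[OF indep])
  have \<phi>[measurable]: "\<phi> \<in> borel_measurable (lborel_vec d)"
    unfolding \<phi>_def by measurable
  have "(\<integral>\<omega>. \<phi> (U \<omega>) \<partial>M) = (\<integral>\<omega>'. (\<integral>\<omega>. iexp (t * dot d (U \<omega>) (V \<omega>')) \<partial>M) \<partial>M)"
    unfolding \<phi>_def
    by (rule MM.Fubini_integral[symmetric], rule MM.integrable_const_bound[of _ 1]) auto
  also have "\<dots> = (\<integral>\<omega>'. complex_of_real (\<psi> (t\<^sup>2 * (L2_set (V \<omega>') {..<d})\<^sup>2)) \<partial>M)"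
  proof -
    have "(\<integral>\<omega>. iexp (t * dot d (U \<omega>) y) \<partial>M) = complex_of_real (\<psi> (t\<^sup>2 * (L2_set y {..<d})\<^sup>2))" for y
      using char[of "\<lambda>i. t * y i"] by (simp only: dot_scale_left L2_set_scale_power2 dot_commute[of d y])
    then show ?thesis by (simp only:)
  qed
  finally have E1: "(\<integral>\<omega>. \<phi> (U \<omega>) \<partial>M) = complex_of_real (\<integral>\<omega>. \<psi> (t\<^sup>2 * (L2_set (V \<omega>) {..<d})\<^sup>2) \<partial>M)"
    by (simp only: integral_complex_of_real)
  have sq: "complex_of_real ((cmod (\<phi> x))\<^sup>2) =
      (\<integral>p. iexp (t * (dot d x (V (fst p)) - dot d x (V (snd p)))) \<partial>(M \<Otimes>\<^sub>M M))"
    if x[measurable]: "x \<in> space (lborel_vec d)" for x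
  proof -
    have cnj: "cnj (\<phi> x) = (\<integral>\<omega>. iexp (- (t * dot d x (V \<omega>))) \<partial>M)"
    proof -
      have "cnj (iexp y) = iexp (- y)" for y unfolding cis_conv_exp[symmetric] by (rule cis_cnj)
      from this[symmetric] show ?thesis unfolding \<phi>_def by (simp only: Bochner_Integration.integral_cnj)
    qed
    have "complex_of_real ((cmod (\<phi> x))\<^sup>2) = \<phi> x * cnj (\<phi> x)" by (rule complex_norm_square)
    also have "\<dots> = (\<integral>\<omega>. (\<integral>\<omega>'. iexp (t * dot d x (V \<omega>)) * iexp (- (t * dot d x (V \<omega>'))) \<partial>M) \<partial>M)"
      unfolding cnj unfolding \<phi>_def by (simp only: integral_mult_right_zero integral_mult_left_zero)
    also have "\<dots> = (\<integral>\<omega>. (\<integral>\<omega>'. iexp (t * (dot d x (V (fst (\<omega>, \<omega>'))) - dot d x (V (snd (\<omega>, \<omega>'))))) \<partial>M) \<partial>M)"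
      by (simp add: exp_add[symmetric] algebra_simps)
    also have "\<dots> = (\<integral>p. iexp (t * (dot d x (V (fst p)) - dot d x (V (snd p)))) \<partial>(M \<Otimes>\<^sub>M M))"
      by (rule MM.integral_fst', rule MM.P.integrable_const_bound[of _ 1]) auto
    finally show ?thesis .
  qed
  have "complex_of_real (\<integral>\<omega>. (cmod (\<phi> (U \<omega>)))\<^sup>2 \<partial>M) = (\<integral>\<omega>. complex_of_real ((cmod (\<phi> (U \<omega>)))\<^sup>2) \<partial>M)"
    by (simp only: integral_complex_of_real)
  also have "\<dots> = (\<integral>\<omega>. (\<integral>p. iexp (t * (dot d (U \<omega>) (V (fst p)) - dot d (U \<omega>) (V (snd p)))) \<partial>(M \<Otimes>\<^sub>M M)) \<partial>M)"
    by (intro Bochner_Integration.integral_cong refl sq measurable_space[OF U])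
  also have "\<dots> = (\<integral>p. (\<integral>\<omega>. iexp (t * (dot d (U \<omega>) (V (fst p)) - dot d (U \<omega>) (V (snd p)))) \<partial>M) \<partial>(M \<Otimes>\<^sub>M M))"
    by (rule MMM.Fubini_integral[symmetric], rule MMM.P.integrable_const_bound[of _ 1]) auto
  also have "\<dots> = (\<integral>p. complex_of_real (\<psi> (t\<^sup>2 * (L2_set (\<lambda>i. V (fst p) i - V (snd p) i) {..<d})\<^sup>2)) \<partial>(M \<Otimes>\<^sub>M M))"
  proof -
    have "(\<integral>\<omega>. iexp (t * (dot d (U \<omega>) y - dot d (U \<omega>) z)) \<partial>M) =
        complex_of_real (\<psi> (t\<^sup>2 * (L2_set (\<lambda>i. y i - z i) {..<d})\<^sup>2))" for y z
      using char[of "\<lambda>i. t * (y i - z i)"]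
      by (simp only: dot_scale_left dot_diff_left L2_set_scale_power2 dot_commute[of d y] dot_commute[of d z])
    then show ?thesis by (simp only:)
  qed
  finally have E2: "(\<integral>\<omega>. (cmod (\<phi> (U \<omega>)))\<^sup>2 \<partial>M) =
      (\<integral>(\<omega>, \<omega>'). \<psi> (t\<^sup>2 * (L2_set (\<lambda>i. V \<omega> i - V \<omega>' i) {..<d})\<^sup>2) \<partial>(M \<Otimes>\<^sub>M M))"
    by (simp only: integral_complex_of_real of_real_eq_iff case_prod_unfold)
  have "(\<integral>\<omega>. (cmod (cond_char M (lborel_vec d) U (\<lambda>\<omega>. dot d (U \<omega>) (V \<omega>)) t \<omega>))\<^sup>2 \<partial>M) =
      (\<integral>\<omega>. (cmod (\<phi> (U \<omega>)))\<^sup>2 \<partial>M)"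
    using AE by (intro integral_cong_AE) auto
  moreover have "(\<integral>\<omega>. cond_char M (lborel_vec d) U (\<lambda>\<omega>. dot d (U \<omega>) (V \<omega>)) t \<omega> \<partial>M) = (\<integral>\<omega>. \<phi> (U \<omega>) \<partial>M)"
    using AE by (intro integral_cong_AE) auto
  ultimately show ?thesis by (simp add: var_cond_char_def E1 E2)
qed

section \<open>Spherical characteristic functions\<close>

text \<open>Only the N diagonal entries deviate from \<kappa>, so the error is linear in N while the
  main term is quadratic; the covariance estimate exploits this gap.\<close>

lemma sum_sum_diagonal_bound:
  fixes E :: "nat \<Rightarrow> nat \<Rightarrow> real"
  assumes off: "\<And>i j. i < N \<Longrightarrow> j < N \<Longrightarrow> i \<noteq> j \<Longrightarrow> E i j = \<kappa>"
    and diag: "\<And>i. i < N \<Longrightarrow> \<bar>E i i - \<kappa>\<bar> \<le> b"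
  shows "\<bar>(\<Sum>i<N. \<Sum>j<N. E i j) - (real N)\<^sup>2 * \<kappa>\<bar> \<le> b * real N"
proof -
  have "(\<Sum>i<N. \<Sum>j<N. E i j) - (real N)\<^sup>2 * \<kappa> = (\<Sum>i<N. \<Sum>j<N. E i j - \<kappa>)"
    by (simp add: sum_subtractf power2_eq_square)
  also have "\<dots> = (\<Sum>i<N. \<Sum>j<N. if j = i then E i i - \<kappa> else 0)"
    by (intro sum.cong) (auto simp: off)
  also have "\<dots> = (\<Sum>i<N. E i i - \<kappa>)" by simp
  also have "\<bar>\<dots>\<bar> \<le> (\<Sum>i<N. b)"
    using diag by (intro order_trans[OF sum_abs] sum_mono) auto
  finally show ?thesis by (simp add: mult.commute)
qed

text \<open>Sums \<open>W x\<close> of N centred cosines have mixed moments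
  \<open>(real N)\<^sup>2 * \<kappa> x y\<close> up to 6 * N. The doubling hypotheses say that
  \<kappa> vanishes at (a, a) and (b, b), so the second moments of \<open>W a\<close> and
  \<open>W b\<close> are only linear in N. Their mixed moment is then linear too, which forces
  \<kappa> at (a, b) to be of order 1 / N.\<close>

lemma (in prob_space) spherical_char_covariance_bound:
  fixes \<psi> :: "real \<Rightarrow> real"
  assumes U[measurable]: "U \<in> measurable M (lborel_vec d)" and N: "N \<le> d"
    and char: "\<And>u. (\<integral>\<omega>. iexp (dot d u (U \<omega>)) \<partial>M) = complex_of_real (\<psi> ((L2_set u {..<d})\<^sup>2))"
    and a: "0 \<le> a" "\<psi> (2 * a) = (\<psi> a)\<^sup>2" and b: "0 \<le> b" "\<psi> (2 * b) = (\<psi> b)\<^sup>2"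
    and bound: "\<And>x. \<bar>\<psi> x\<bar> \<le> 1"
  shows "real N * \<bar>\<psi> (a + b) - \<psi> a * \<psi> b\<bar> \<le> 12"
proof -
  have U'[measurable]: "(\<lambda>\<omega>. U \<omega> i) \<in> borel_measurable M" if "i < d" for i
    using measurable_compose[OF U measurable_component_singleton, of i] that by simp
  have dotU[measurable]: "(\<lambda>\<omega>. dot d u (U \<omega>)) \<in> borel_measurable M" for u
    unfolding dot_def using U' by (intro borel_measurable_sum borel_measurable_times) auto
  have cos_char: "(\<integral>\<omega>. cos (dot d u (U \<omega>)) \<partial>M) = \<psi> ((L2_set u {..<d})\<^sup>2)" for u
  proof -
    have "(\<integral>\<omega>. cos (dot d u (U \<omega>)) \<partial>M) = (\<integral>\<omega>. Re (iexp (dot d u (U \<omega>))) \<partial>M)"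
      by (simp flip: cis_conv_exp)
    also have "\<dots> = Re (\<integral>\<omega>. iexp (dot d u (U \<omega>)) \<partial>M)"
      by (intro integral_Re integrable_iexp) auto
    finally show ?thesis by (simp add: char)
  qed
  have delta: "(\<Sum>k<d. (if k = i then x else 0) * v k) = x * v i" if "i < d" for i x and v :: "nat \<Rightarrow> real"
    using that by (simp add: if_distrib[of "\<lambda>y. y * _"] cong: if_cong)
  \<comment> \<open>With frequency sqrt x in the single direction i, the squared norm is x, so the
    mean is \<open>\<psi> x\<close>.\<close>
  define C where "C x i \<omega> = cos (sqrt x * U \<omega> i)" for x i \<omega>
  have Cm[measurable]: "C x i \<in> borel_measurable M" if "i < d" for x i
    unfolding C_def using U'[OF that] by measurable
  have EC: "(\<integral>\<omega>. C x i \<omega> \<partial>M) = \<psi> x" if "0 \<le> x" "i < d" for x i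
  proof -
    let ?u = "\<lambda>k. if k = i then sqrt x else 0"
    have "dot d ?u v = sqrt x * v i" for v using that(2) by (simp only: dot_def delta)
    moreover have "(L2_set ?u {..<d})\<^sup>2 = x"
      unfolding dot_self[symmetric] using that by (simp only: dot_def delta) simp
    ultimately show ?thesis using cos_char[of ?u] by (simp add: C_def)
  qed
  have ECC: "(\<integral>\<omega>. C x i \<omega> * C y j \<omega> \<partial>M) = \<psi> (x + y)" if "0 \<le> x" "0 \<le> y" "i < d" "j < d" "i \<noteq> j" for x y i j
  proof -
    \<comment> \<open>The product-to-sum formula needs the frequencies with s = 1 and s = -1. Since
      i and j differ, both vectors have squared norm x + y, so the two cosine means
      coincide.\<close>
    let ?u = "\<lambda>s k. (if k = i then sqrt x else 0) + (if k = j then s * sqrt y else 0)"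
    have d: "dot d (?u s) v = sqrt x * v i + s * sqrt y * v j" for s v
      using that(3,4) by (simp only: dot_def distrib_right sum.distrib delta)
    have l: "(L2_set (?u s) {..<d})\<^sup>2 = x + y" if "s\<^sup>2 = 1" for s
      unfolding dot_self[symmetric] d using \<open>i \<noteq> j\<close> \<open>0 \<le> x\<close> \<open>0 \<le> y\<close> that
      by (simp add: power2_eq_square mult_ac)
    have "(\<integral>\<omega>. C x i \<omega> * C y j \<omega> \<partial>M) = (\<integral>\<omega>. (cos (dot d (?u (-1)) (U \<omega>)) + cos (dot d (?u 1) (U \<omega>))) / 2 \<partial>M)"
      unfolding C_def d by (simp add: cos_times_cos)
    also have "\<dots> = ((\<integral>\<omega>. cos (dot d (?u (-1)) (U \<omega>)) \<partial>M) + (\<integral>\<omega>. cos (dot d (?u 1) (U \<omega>)) \<partial>M)) / 2"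
    proof -
      have "integrable M (\<lambda>\<omega>. cos (dot d u (U \<omega>)))" for u
        by (rule integrable_const_bound[of _ 1]) auto
      then show ?thesis by (simp only: integral_divide_zero Bochner_Integration.integral_add)
    qed
    also have "\<dots> = \<psi> (x + y)" unfolding cos_char by (simp add: l)
    finally show ?thesis .
  qed
  define D where "D x i \<omega> = C x i \<omega> - \<psi> x" for x i \<omega>
  have Dm[measurable]: "D x i \<in> borel_measurable M" if "i < d" for x i
    unfolding D_def using Cm[OF that] by measurable
  have D2: "\<bar>D x i \<omega>\<bar> \<le> 2" for x i \<omega>
    using bound[of x] abs_cos_le_one[of "sqrt x * U \<omega> i"] unfolding D_def C_def by linarith
  have DD4: "\<bar>D x i \<omega> * D y j \<omega>\<bar> \<le> 4" for x y i j \<omega>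
    using mult_mono[OF D2[of x i \<omega>] D2[of y j \<omega>]] by (simp add: abs_mult)
  have intDD: "integrable M (\<lambda>\<omega>. D x i \<omega> * D y j \<omega>)" if "i < d" "j < d" for x y i j
    using DD4 Dm that by (intro integrable_const_bound[of _ 4]) auto
  define \<kappa> where "\<kappa> x y = \<psi> (x + y) - \<psi> x * \<psi> y" for x y
  have EDD: "(\<integral>\<omega>. D x i \<omega> * D y j \<omega> \<partial>M) = \<kappa> x y" if "0 \<le> x" "0 \<le> y" "i < d" "j < d" "i \<noteq> j" for x y i j
  proof -
    have int: "integrable M (C x i)" "integrable M (C y j)" "integrable M (\<lambda>\<omega>. C x i \<omega> * C y j \<omega>)"
      using that Cm by (auto intro!: integrable_const_bound[of _ 1] simp: C_def abs_mult mult_le_one)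
    have "(\<integral>\<omega>. D x i \<omega> * D y j \<omega> \<partial>M) = (\<integral>\<omega>. C x i \<omega> * C y j \<omega> - \<psi> y * C x i \<omega> - \<psi> x * C y j \<omega> + \<psi> x * \<psi> y \<partial>M)"
      unfolding D_def by (simp add: algebra_simps)
    also have "\<dots> = \<kappa> x y"
      using int EC[OF that(1,3)] EC[OF that(2,4)] ECC[OF that] by (simp add: prob_space \<kappa>_def)
    finally show ?thesis .
  qed
  define W where "W x \<omega> = (\<Sum>i<N. D x i \<omega>)" for x \<omega>
  have WW: "W x \<omega> * W y \<omega> = (\<Sum>i<N. \<Sum>j<N. D x i \<omega> * D y j \<omega>)" for x y \<omega>
    unfolding W_def by (rule sum_product)
  have intWW: "integrable M (\<lambda>\<omega>. W x \<omega> * W y \<omega>)" for x y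
    unfolding WW using N by (intro Bochner_Integration.integrable_sum intDD) auto
  have EWW: "\<bar>(\<integral>\<omega>. W x \<omega> * W y \<omega> \<partial>M) - (real N)\<^sup>2 * \<kappa> x y\<bar> \<le> 6 * real N" if "0 \<le> x" "0 \<le> y" for x y
  proof -
    have "(\<integral>\<omega>. W x \<omega> * W y \<omega> \<partial>M) = (\<Sum>i<N. \<Sum>j<N. (\<integral>\<omega>. D x i \<omega> * D y j \<omega> \<partial>M))"
      unfolding WW using N intDD
      by (subst Bochner_Integration.integral_sum; (intro Bochner_Integration.integrable_sum sum.cong Bochner_Integration.integral_sum)?) auto
    \<comment> \<open>The 6 is 4 for the diagonal expectation plus 2 for \<kappa>, whose two terms
      are each at most 1 in modulus.\<close>
    moreover have "\<bar>(\<integral>\<omega>. D x i \<omega> * D y i \<omega> \<partial>M) - \<kappa> x y\<bar> \<le> 6" for i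
    proof -
      have "\<bar>\<integral>\<omega>. D x i \<omega> * D y i \<omega> \<partial>M\<bar> \<le> (\<integral>\<omega>. \<bar>D x i \<omega> * D y i \<omega>\<bar> \<partial>M)" by (rule integral_abs_bound)
      also have "\<dots> \<le> (\<integral>\<omega>. 4 \<partial>M)" by (rule Bochner_Integration.integral_mono') (use DD4 in auto)
      finally have "\<bar>\<integral>\<omega>. D x i \<omega> * D y i \<omega> \<partial>M\<bar> \<le> 4" by (simp add: prob_space)
      moreover have "\<bar>\<psi> x * \<psi> y\<bar> \<le> 1" using bound by (simp add: abs_mult mult_le_one)
      ultimately show ?thesis using bound[of "x + y"] unfolding \<kappa>_def by linarith
    qed
    ultimately show ?thesis using N that by (simp only:) (intro sum_sum_diagonal_bound, auto intro!: EDD)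
  qed
  have \<kappa>0: "\<kappa> a a = 0" "\<kappa> b b = 0"
    using a(2) b(2) by (simp_all add: \<kappa>_def power2_eq_square flip: mult_2)
  have sq: "(\<integral>\<omega>. W a \<omega> * W a \<omega> \<partial>M) \<le> 6 * real N" "(\<integral>\<omega>. W b \<omega> * W b \<omega> \<partial>M) \<le> 6 * real N"
    using EWW[OF a(1) a(1)] EWW[OF b(1) b(1)] by (simp_all add: \<kappa>0)
  have "\<bar>\<integral>\<omega>. W a \<omega> * W b \<omega> \<partial>M\<bar> \<le> (\<integral>\<omega>. \<bar>W a \<omega> * W b \<omega>\<bar> \<partial>M)" by (rule integral_abs_bound)
  \<comment> \<open>The arithmetic-geometric mean inequality takes the place of
    Cauchy-Schwarz.\<close>
  also have "\<dots> \<le> (\<integral>\<omega>. (W a \<omega> * W a \<omega> + W b \<omega> * W b \<omega>) / 2 \<partial>M)"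
  proof (rule integral_mono)
    show "\<bar>W a \<omega> * W b \<omega>\<bar> \<le> (W a \<omega> * W a \<omega> + W b \<omega> * W b \<omega>) / 2" for \<omega>
      using sum_squares_ge_zero[of "W a \<omega> - W b \<omega>" 0] sum_squares_ge_zero[of "W a \<omega> + W b \<omega>" 0]
      by (auto simp: abs_if algebra_simps)
  qed (use intWW in auto)
  also have "\<dots> \<le> 6 * real N" using intWW sq by simp
  \<comment> \<open>One 6 * N bounds the mixed moment, the other is its distance from the main
    term.\<close>
  finally have "\<bar>(real N)\<^sup>2 * \<kappa> a b\<bar> \<le> 12 * real N"
    using EWW[OF a(1) b(1)] by linarith
  then have "real N * (real N * \<bar>\<kappa> a b\<bar>) \<le> real N * 12" by (simp add: abs_mult power2_eq_square mult_ac)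
  then show ?thesis unfolding \<kappa>_def by (cases "N = 0") auto
qed

section \<open>Densities against a point mass at 0\<close>

text \<open>The hyperplane is a box with one degenerate side, so its product measure has a factor
  0.\<close>

lemma lborel_vec_coordinate_null:
  assumes "i < d"
  shows "{x \<in> space (lborel_vec d). x i = 0} \<in> null_sets (lborel_vec d)"
proof -
  let ?A = "\<lambda>j. if j = i then {0} else UNIV :: real set"
  have "{x \<in> space (lborel_vec d). x i = 0} = Pi\<^sub>E {..<d} ?A"
  proof (intro equalityI subsetI)
    fix x assume "x \<in> Pi\<^sub>E {..<d} ?A"
    then show "x \<in> {x \<in> space (lborel_vec d). x i = 0}"
      using assms PiE_mem[of x "{..<d}" ?A i] by (auto simp: space_PiM PiE_iff)
  qed (auto simp: space_PiM PiE_iff)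
  moreover have "emeasure (lborel_vec d) (Pi\<^sub>E {..<d} ?A) = (\<Prod>j<d. emeasure lborel (?A j))"
    by (rule lborel_product.emeasure_PiM) auto
  moreover have "(\<Prod>j<d. emeasure lborel (?A j)) = 0"
    using assms by (intro prod_zero) (auto intro!: bexI[of _ i])
  moreover have "Pi\<^sub>E {..<d} ?A \<in> sets (lborel_vec d)" by (rule sets_PiM_I_finite) auto
  ultimately show ?thesis by (simp add: null_sets_def)
qed

lemma (in prob_space) prob_distributed_coordinate_eq_0:
  assumes U: "distributed M (lborel_vec d) U f" and i: "i < d"
  shows "prob {\<omega> \<in> space M. U \<omega> i = 0} = 0"
proof -
  note [measurable] = distributed_measurable[OF U] distributed_borel_measurable[OF U]
  let ?N = "{x \<in> space (lborel_vec d). x i = 0}"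
  have N: "?N \<in> null_sets (lborel_vec d)" using i by (rule lborel_vec_coordinate_null)
  have "emeasure M (U -` ?N \<inter> space M) = (\<integral>\<^sup>+x. f x * indicator ?N x \<partial>lborel_vec d)"
    using N by (intro distributed_emeasure[OF U]) auto
  also have "\<dots> = 0"
    using nn_integral_null_set[OF N] by simp
  also have "U -` ?N \<inter> space M = {\<omega> \<in> space M. U \<omega> i = 0}"
    using measurable_space[OF distributed_measurable[OF U]] by auto
  finally show ?thesis by (simp add: measure_def)
qed

text \<open>The constant 1 is the characteristic function of the point mass at 0, so uniqueness
  identifies the law of Z with it.\<close>

lemma (in prob_space) prob_eq_0_if_char_eq_1:
  assumes [measurable]: "Z \<in> borel_measurable M" and char: "\<And>t. char (distr M borel Z) t = 1"
  shows "prob {\<omega> \<in> space M. Z \<omega> = 0} = 1"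
proof -
  interpret R: prob_space "return borel (0::real)" by (rule prob_space_return) simp
  have X: "char (return borel (0::real)) t = 1" for t
  proof -
    have "char (return borel (0::real)) t = iexp (t * 0)"
      unfolding char_def by (rule integral_return) simp_all
    then show ?thesis by simp
  qed
  have rd: "real_distribution (return borel (0::real))"
      by (simp add: real_distribution_def real_distribution_axioms_def R.prob_space_axioms)
  have "char (distr M borel Z) = char (return borel 0)" using char X by (intro ext) simp
  then have "distr M borel Z = return borel 0"
    by (intro Levy_uniqueness real_distribution_distr assms rd)
  then have "measure (distr M borel Z) {0} = 1" by (simp add: measure_def)
  then show ?thesis by (subst (asm) measure_distr) (auto simp: vimage_def Int_def conj_commute)
qed

theorem theorem2p5:
  fixes M :: "'a measure"
    and d :: "nat \<Rightarrow> nat"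
    and X \<Xi> :: "nat \<Rightarrow> 'a \<Rightarrow> nat \<Rightarrow> real"
    and Y :: "nat \<Rightarrow> 'a \<Rightarrow> real"
    and \<sigma> :: real
    and \<psi>\<^sub>0 :: "real \<Rightarrow> real"
  assumes "prob_space M"
    and "mono d" and "\<And>n. 0 < d n" and "filterlim d at_top at_top"
    and "0 < \<sigma>\<^sup>2"
    and "\<And>n. continuous_random_vector M (d n) (X n)"
    and "\<And>n. continuous_random_vector M (d n) (\<Xi> n)"
    and "conv_in_prob M (\<lambda>n \<omega>. (L2_set (X n \<omega>) {..<d n})\<^sup>2) (\<sigma>\<^sup>2)"
    and "conv_in_prob_dot_indep_copy M d X 0"
    and "prob_space.indep_var M
           (PiM UNIV (\<lambda>n. lborel_vec (d n))) (\<lambda>\<omega> n. \<Xi> n \<omega>)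
           (PiM UNIV (\<lambda>n. lborel_vec (d n))) (\<lambda>\<omega> n. X n \<omega>)"
    and "\<And>n (u :: nat \<Rightarrow> real).
           (\<integral>\<omega>. iexp (dot (d n) u (\<Xi> n \<omega>)) \<partial>M) = complex_of_real (\<psi>\<^sub>0 ((L2_set u {..<d n})\<^sup>2))"
    and "\<And>n \<omega>. Y n \<omega> = dot (d n) (\<Xi> n \<omega>) (X n \<omega>)"
  shows "(\<exists>\<sigma>\<^sub>0. \<forall>n. isotropic_normal M (d n) \<sigma>\<^sub>0 (\<Xi> n)) \<longleftrightarrow>
    (\<forall>t::real. (\<lambda>n. var_cond_char M (lborel_vec (d n)) (\<Xi> n) (Y n) t) \<longlonglongrightarrow> 0)"
proof -
  note d_pos = assms(3) and d_top = assms(4) and \<sigma> = assms(5) and norm_conv = assms(8)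
    and dot_conv = assms(9) and char = assms(11)
  interpret prob_space M by (rule assms(1))
  interpret MM: pair_prob_space M M ..
  \<comment> \<open>Projecting both independent sequences to their n-th entries preserves
    independence.\<close>
  have indep: "indep_var (lborel_vec (d n)) (\<Xi> n) (lborel_vec (d n)) (X n)" for n
  proof -
    have "(\<lambda>x. x n) \<in> measurable (PiM UNIV (\<lambda>n. lborel_vec (d n))) (lborel_vec (d n))"
      by (rule measurable_component_singleton) simp
    from indep_var_compose[OF assms(10) this this] show ?thesis by (simp only: comp_def)
  qed
  have \<Xi>[measurable]: "\<Xi> n \<in> measurable M (lborel_vec (d n))" for n
    by (rule indep_var_rv1[OF indep])
  have X[measurable]: "X n \<in> measurable M (lborel_vec (d n))" for n
    by (rule indep_var_rv2[OF indep])
  have \<Xi>0[measurable]: "(\<lambda>\<omega>. \<Xi> 0 \<omega> 0) \<in> borel_measurable M"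
    using measurable_compose[OF \<Xi>[of 0] measurable_component_singleton, of 0] d_pos[of 0] by simp

  \<comment> \<open>The values of \<open>\<psi>\<^sub>0\<close> on negative arguments are arbitrary; \<open>\<psi>\<close> extends it continuously.\<close>
  define \<psi> where "\<psi> r = Re (Characteristic_Functions.char (distr M borel (\<lambda>\<omega>. \<Xi> 0 \<omega> 0)) (sqrt r))" for r
  interpret R: real_distribution "distr M borel (\<lambda>\<omega>. \<Xi> 0 \<omega> 0)" by (rule real_distribution_distr) simp
  \<comment> \<open>The test vector is t times the first basis vector, available because d 0 is
    positive; its squared norm is t squared.\<close>
  have char0: "Characteristic_Functions.char (distr M borel (\<lambda>\<omega>. \<Xi> 0 \<omega> 0)) t = complex_of_real (\<psi>\<^sub>0 (t\<^sup>2))" for t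
  proof -
    let ?u = "\<lambda>k::nat. if k = 0 then t else 0"
    have dot0: "dot (d 0) ?u v = t * v 0" for v
      using d_pos[of 0] by (simp add: dot_def if_distrib[of "\<lambda>y. y * _"] cong: if_cong)
    have "(L2_set ?u {..<d 0})\<^sup>2 = t\<^sup>2"
      unfolding dot_self[symmetric] dot0 by (simp add: power2_eq_square)
    then show ?thesis
      using char[of 0 ?u] unfolding dot0 Characteristic_Functions.char_def by (subst integral_distr) auto
  qed
  have \<psi>: "\<psi>\<^sub>0 r = \<psi> r" if "0 \<le> r" for r
    using that by (simp add: \<psi>_def char0)
  have char: "(\<integral>\<omega>. iexp (dot (d n) u (\<Xi> n \<omega>)) \<partial>M) = complex_of_real (\<psi> ((L2_set u {..<d n})\<^sup>2))" for n u
    by (simp only: char \<psi>[OF zero_le_power2])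
  have cont: "isCont \<psi> r" for r
    unfolding \<psi>_def by (intro continuous_Re isCont_o2[OF isCont_real_sqrt R.isCont_char])
  then have [measurable]: "\<psi> \<in> borel_measurable borel"
    by (intro borel_measurable_continuous_onI) (simp add: continuous_on_eq_continuous_at)
  have bound: "\<bar>\<psi> r\<bar> \<le> 1" for r
    unfolding \<psi>_def using abs_Re_le_cmod R.cmod_char_le_1 order_trans by blast

  \<comment> \<open>The limit of the variance\<close>
  have dot_measurable[measurable]: "(\<lambda>(\<omega>, \<omega>'). dot (d n) (X n \<omega>) (X n \<omega>')) \<in> borel_measurable (M \<Otimes>\<^sub>M M)" for n
    by measurable
  have norm_measurable[measurable]: "(\<lambda>\<omega>. (L2_set (X n \<omega>) {..<d n})\<^sup>2) \<in> borel_measurable M" for n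
    unfolding dot_self[symmetric] by measurable
  \<comment> \<open>The squared norm of the difference expands into two squared norms, each tending
    to \<open>\<sigma>\<^sup>2\<close> on its own factor, minus twice the inner product of the
    copies, which tends to 0.\<close>
  have diff_conv: "conv_in_prob (M \<Otimes>\<^sub>M M) (\<lambda>n (\<omega>, \<omega>'). (L2_set (\<lambda>i. X n \<omega> i - X n \<omega>' i) {..<d n})\<^sup>2) (2 * \<sigma>\<^sup>2)"
  proof -
    have fst: "distr (M \<Otimes>\<^sub>M M) M fst = M" by (rule distr_pair_fst)
    \<comment> \<open>Swapping the factors preserves the product measure, so the second marginal
      follows from the first.\<close>
    have "distr (M \<Otimes>\<^sub>M M) M snd = distr (distr (M \<Otimes>\<^sub>M M) (M \<Otimes>\<^sub>M M) (\<lambda>(x, y). (y, x))) M snd"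
      using MM.distr_pair_swap by simp
    also have "\<dots> = M"
      by (subst distr_distr) (auto simp: comp_def case_prod_unfold fst)
    finally have snd: "distr (M \<Otimes>\<^sub>M M) M snd = M" .
    have "conv_in_prob (M \<Otimes>\<^sub>M M) (\<lambda>n p. (L2_set (X n (fst p)) {..<d n})\<^sup>2) (\<sigma>\<^sup>2)"
      "conv_in_prob (M \<Otimes>\<^sub>M M) (\<lambda>n p. (L2_set (X n (snd p)) {..<d n})\<^sup>2) (\<sigma>\<^sup>2)"
      using conv_in_prob_distr_iff[where Z="\<lambda>n \<omega>. (L2_set (X n \<omega>) {..<d n})\<^sup>2", OF measurable_fst norm_measurable fst]
        conv_in_prob_distr_iff[where Z="\<lambda>n \<omega>. (L2_set (X n \<omega>) {..<d n})\<^sup>2", OF measurable_snd norm_measurable snd]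
        norm_conv by blast+
    moreover have "conv_in_prob (M \<Otimes>\<^sub>M M) (\<lambda>n p. - 2 * (case p of (\<omega>, \<omega>') \<Rightarrow> dot (d n) (X n \<omega>) (X n \<omega>'))) (- 2 * 0)"
      using dot_conv unfolding conv_in_prob_dot_indep_copy_def by (rule conv_in_prob_cmult) simp
    ultimately have "conv_in_prob (M \<Otimes>\<^sub>M M) (\<lambda>n p. (L2_set (X n (fst p)) {..<d n})\<^sup>2 + (L2_set (X n (snd p)) {..<d n})\<^sup>2
        + - 2 * (case p of (\<omega>, \<omega>') \<Rightarrow> dot (d n) (X n \<omega>) (X n \<omega>'))) (\<sigma>\<^sup>2 + \<sigma>\<^sup>2 + - 2 * 0)"
      by (intro MM.P.conv_in_prob_add) measurable
    then show ?thesis by (simp add: L2_set_diff_power2 case_prod_unfold)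
  qed
  \<comment> \<open>\<psi> is bounded and continuous, so convergence in probability passes to both
    integrals of \<open>var_cond_char_dot\<close>.\<close>
  have var_lim: "(\<lambda>n. var_cond_char M (lborel_vec (d n)) (\<Xi> n) (Y n) t) \<longlonglongrightarrow> \<psi> (t\<^sup>2 * (2 * \<sigma>\<^sup>2)) - (\<psi> (t\<^sup>2 * \<sigma>\<^sup>2))\<^sup>2" for t
  proof -
    have g: "isCont (\<lambda>r. \<psi> (t\<^sup>2 * r)) r" for r by (intro isCont_o2[OF _ cont] continuous_intros)
    have "(\<lambda>n. \<integral>p. \<psi> (t\<^sup>2 * (case p of (\<omega>, \<omega>') \<Rightarrow> (L2_set (\<lambda>i. X n \<omega> i - X n \<omega>' i) {..<d n})\<^sup>2)) \<partial>(M \<Otimes>\<^sub>M M))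
        \<longlonglongrightarrow> \<psi> (t\<^sup>2 * (2 * \<sigma>\<^sup>2))"
      by (rule MM.P.conv_in_prob_imp_integral_tendsto[OF _ diff_conv g _ bound])
        (simp_all add: L2_set_diff_power2)
    moreover have "(\<lambda>n. \<integral>\<omega>. \<psi> (t\<^sup>2 * (L2_set (X n \<omega>) {..<d n})\<^sup>2) \<partial>M) \<longlonglongrightarrow> \<psi> (t\<^sup>2 * \<sigma>\<^sup>2)"
      by (rule conv_in_prob_imp_integral_tendsto[OF _ norm_conv g _ bound]) simp_all
    moreover have "Y n = (\<lambda>\<omega>. dot (d n) (\<Xi> n \<omega>) (X n \<omega>))" for n using assms(12) by (intro ext)
    ultimately show ?thesis
      using var_cond_char_dot[OF indep char] by (auto intro!: tendsto_diff tendsto_power simp: case_prod_unfold)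
  qed

  show ?thesis
  proof
    assume "\<exists>\<sigma>\<^sub>0. \<forall>n. isotropic_normal M (d n) \<sigma>\<^sub>0 (\<Xi> n)"
    then obtain s where s: "0 < s"
      and \<Xi>_normal: "distributed M (lborel_vec (d 0)) (\<Xi> 0) (\<lambda>x. ennreal (isotropic_normal_density (d 0) s x))"
      unfolding isotropic_normal_def by blast
    \<comment> \<open>The vector with first entry sqrt r and zeros elsewhere has squared norm r, so
      the normal law in dimension d 0 reveals \<psi> on the whole half-line. An exponential
      satisfies the doubling identity, which makes the limit variance 0.\<close>
    have \<psi>_exp: "\<psi> r = exp (- (s\<^sup>2 / 2) * r)" if "0 \<le> r" for r
    proof -
      let ?u = "\<lambda>k::nat. if k = 0 then sqrt r else 0"
      have u: "(L2_set ?u {..<d 0})\<^sup>2 = r"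
        unfolding dot_self[symmetric] using d_pos[of 0] that
        by (simp add: dot_def if_distrib[of "\<lambda>y. y * _"] cong: if_cong)
      have "complex_of_real (\<psi> r) = (\<integral>\<omega>. iexp (dot (d 0) ?u (\<Xi> 0 \<omega>)) \<partial>M)"
        by (simp only: char u)
      also have "\<dots> = (\<integral>x. iexp (dot (d 0) ?u x) \<partial>distr M (lborel_vec (d 0)) (\<Xi> 0))"
        by (rule integral_distr[symmetric]) (auto simp: dot_def)
      also have "\<dots> = complex_of_real (exp (- (s\<^sup>2 / 2) * r))"
        unfolding distributed_distr_eq_density[OF \<Xi>_normal] char_isotropic_normal[OF s] u ..
      finally show ?thesis by (simp only: of_real_eq_iff)
    qed
    have "\<psi> (t\<^sup>2 * (2 * \<sigma>\<^sup>2)) - (\<psi> (t\<^sup>2 * \<sigma>\<^sup>2))\<^sup>2 = 0" for t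
      by (simp add: \<psi>_exp exp_double[symmetric] algebra_simps)
    then show "\<forall>t. (\<lambda>n. var_cond_char M (lborel_vec (d n)) (\<Xi> n) (Y n) t) \<longlonglongrightarrow> 0"
      using var_lim by metis
  next
    assume var_0: "\<forall>t. (\<lambda>n. var_cond_char M (lborel_vec (d n)) (\<Xi> n) (Y n) t) \<longlonglongrightarrow> 0"
    \<comment> \<open>Since \<sigma> is nonzero, t = sqrt (r / \<open>\<sigma>\<^sup>2\<close>)
      realizes any prescribed r as the argument of \<psi> in the limit.\<close>
    have double: "\<psi> (2 * r) = (\<psi> r)\<^sup>2" if "0 \<le> r" for r
    proof -
      have "(sqrt (r / \<sigma>\<^sup>2))\<^sup>2 * \<sigma>\<^sup>2 = r" using that \<sigma> by simp
      moreover have "\<psi> ((sqrt (r / \<sigma>\<^sup>2))\<^sup>2 * (2 * \<sigma>\<^sup>2)) - (\<psi> ((sqrt (r / \<sigma>\<^sup>2))\<^sup>2 * \<sigma>\<^sup>2))\<^sup>2 = 0"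
        using LIMSEQ_unique[OF var_lim var_0[rule_format]] .
      ultimately show ?thesis by (metis eq_iff_diff_eq_0 mult.left_commute)
    qed
    have "\<psi> (a + b) = \<psi> a * \<psi> b" if ab: "0 \<le> a" "0 \<le> b" for a b
    proof (rule ccontr)
      assume "\<psi> (a + b) \<noteq> \<psi> a * \<psi> b"
      then have "0 < \<bar>\<psi> (a + b) - \<psi> a * \<psi> b\<bar>" by simp
      \<comment> \<open>If multiplicativity failed, some N would push the scaled defect above the
        universal bound 12; as the dimensions are unbounded, some \<open>\<Xi> n\<close> has at
        least N coordinates.\<close>
      then obtain N :: nat where N: "12 < real N * \<bar>\<psi> (a + b) - \<psi> a * \<psi> b\<bar>"
        using ex_less_of_nat_mult by blast
      obtain n where "N \<le> d n"
        using d_top unfolding filterlim_at_top eventually_sequentially by blast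
      from spherical_char_covariance_bound[OF \<Xi> this char ab(1) double[OF ab(1)] ab(2) double[OF ab(2)] bound]
      show False using N by simp
    qed
    moreover have "continuous_on {0..} \<psi>" using cont by (simp add: continuous_at_imp_continuous_on)
    moreover have "\<psi> 0 = 1" using R.char_zero by (simp add: \<psi>_def)
    ultimately obtain c where c: "\<And>r. 0 \<le> r \<Longrightarrow> \<psi> r = exp (c * r)"
      using multiplicative_eq_exp[of \<psi>] by blast
    \<comment> \<open>For c = 0 the first coordinate of \<open>\<Xi> 0\<close> would be almost
      surely 0, whereas its density gives that event probability 0.\<close>
    have "c \<noteq> 0"
    proof
      assume "c = 0"
      then have "prob {\<omega> \<in> space M. \<Xi> 0 \<omega> 0 = 0} = 1"
        by (intro prob_eq_0_if_char_eq_1) (simp_all add: char0 \<psi> c)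
      moreover obtain f where "distributed M (lborel_vec (d 0)) (\<Xi> 0) f"
        using assms(7)[of 0] unfolding continuous_random_vector_def by blast
      ultimately show False using prob_distributed_coordinate_eq_0 d_pos[of 0] by fastforce
    qed
    \<comment> \<open>A characteristic function has modulus at most 1, so its exponent cannot be
      positive. Matching c with minus half the variance gives the variance -2 * c.\<close>
    moreover have "c \<le> 0" using bound[of 1] c[of 1] by simp
    ultimately have s: "0 < sqrt (- 2 * c)" and s2: "- ((sqrt (- 2 * c))\<^sup>2 / 2) = c" by auto
    have "isotropic_normal M (d n) (sqrt (- 2 * c)) (\<Xi> n)" for n
    proof -
      have "distr M (lborel_vec (d n)) (\<Xi> n) =
          density (lborel_vec (d n)) (\<lambda>x. ennreal (isotropic_normal_density (d n) (sqrt (- 2 * c)) x))"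
      proof (rule PiM_char_uniqueness[OF prob_space_distr[OF \<Xi>] prob_space_isotropic_normal[OF s]])
        fix u
        have "(\<integral>x. iexp (dot (d n) u x) \<partial>distr M (lborel_vec (d n)) (\<Xi> n)) = (\<integral>\<omega>. iexp (dot (d n) u (\<Xi> n \<omega>)) \<partial>M)"
          by (rule integral_distr) (auto simp: dot_def)
        then show "(\<integral>x. iexp (dot (d n) u x) \<partial>distr M (lborel_vec (d n)) (\<Xi> n)) =
            (\<integral>x. iexp (dot (d n) u x) \<partial>density (lborel_vec (d n)) (\<lambda>x. ennreal (isotropic_normal_density (d n) (sqrt (- 2 * c)) x)))"
          unfolding char_isotropic_normal[OF s] s2 char c[OF zero_le_power2] .
      qed auto
      then show ?thesis unfolding isotropic_normal_def distributed_def using s by auto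
    qed
    then show "\<exists>\<sigma>\<^sub>0. \<forall>n. isotropic_normal M (d n) \<sigma>\<^sub>0 (\<Xi> n)" by blast
  qed
qed

end
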